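(* Let $X\subseteq\mathbb{R}^n$ and $Y\subseteq\mathbb{R}^m$ be convex compact sets, $A:\mathbb{R}^n\to\mathbb{R}^m$ a linear operator, $\hat f:Y\to\mathbb{R}$ a convex function, and consider the problem $\min_{x\in X}f(x)$ with $$f(x)=\max_{y\in Y}\{\langle Ax,y\rangle-\hat f(y)\}.$$ Let $\omega$, $\sigma_\omega$, $W$, $\mathcal{D}_{Y,W}$, $f_\tau$ and $\mathcal{L}_\tau=\|A\|^2/(\tau\sigma_\omega)$ be as in the context. Assume the outer iteration limit $N\ge1$ is given. If $$\tau_k\equiv\tau=\frac{2\|A\|D_X}{\mathcal{D}_{Y,W}\sqrt{\sigma_\omega}N},\quad k\ge1,$$ and the other parameters used in the CALGD method for saddle point problems (see context) are $$\beta_k=\frac{3\mathcal{L}_{\tau_k}}{k+1},\quad\gamma_k=\frac3{k+2},\quad\eta_k=\frac{\mathcal{L}_{\tau_k}D_X^2}{k^2},\quad k\ge1,$$ then the number of linear operator evaluations (for $A$ and $A^T$) and the number of calls to the LOsep oracle performed by this method for finding an $\epsilon$-solution of $\min_{x\in X}f(x)$ are bounded, respectively, by $$\mathcal{O}\left\{\frac{\|A\|D_X\mathcal{D}_{Y,W}}{\sqrt{\sigma_\omega}\,\epsilon}\right\}\quad\text{and}\quad\mathcal{O}\left\{\frac{\|A\|^2D_X^2\mathcal{D}_{Y,W}^2}{\sigma_\omega\epsilon^2}\right\}.$$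
   Context: $\|\cdot\|$ is the norm associated with the inner product, $D_X=\max_{x,y\in X}\|x-y\|$, $\|A\|=\max_{\|x\|\le1}\|Ax\|$. An $\epsilon$-solution is $\bar x\in X$ with $f(\bar x)-\min_Xf\le\epsilon$. $\mathcal{O}(\cdot)$ hides a constant factor depending only on $\alpha$; the bound is for all sufficiently small $\epsilon>0$ (the threshold may depend on the other data), with $N$ chosen of the order needed to reach accuracy $\epsilon$. Smoothing: $\omega:Y\to\mathbb{R}$ is a given differentiable strongly convex function with modulus $\sigma_\omega>0$: $\omega(y)\ge\omega(x)+\langle\omega'(x),y-x\rangle+\frac{\sigma_\omega}2\|y-x\|^2$ for $x,y\in Y$. $c_\omega:=\operatorname{argmin}_{y\in Y}\omega(y)$, $W(y):=\omega(y)-\omega(c_\omega)-\langle\nabla\omega(c_\omega),y-c_\omega\rangle$, $\mathcal{D}_{Y,W}^2:=\max_{y\in Y}W(y)$, and $f_\tau(x):=\max_{y\in Y}\{\langle Ax,y\rangle-\hat f(y)-\tau[W(y)-\mathcal{D}_{Y,W}^2]\}$. For $\tau>0$, $f_\tau$ is differentiable with $\mathcal{L}_\tau$-Lipschitz gradient. The maximization over $Y$ defining $f_\tau$ is assumed to be solvable, so that each gradient $f'_\tau$ costs a constant number of evaluations of $A$ and $A^T$. CALGD method for saddle point problems. Input: $x_0\in X$, $N$, $\alpha\ge1$, parameters $\beta_k>0,\gamma_k\in[0,1],\eta_k\ge0,\tau_k\ge0$. Set $y_0=x_0$. For $k=1,\dots,N$: $z_k=(1-\gamma_k)y_{k-1}+\gamma_kx_{k-1}$;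 $x_k=\mathrm{LCG}(f'_{\tau_k}(z_k),\beta_k,x_{k-1},\alpha,\eta_k)$; $y_k=(1-\gamma_k)y_{k-1}+\gamma_kx_k$. Output $y_N$. Here $\mathrm{LCG}(g,\beta,x,\alpha,\eta)$ is the output of the LCG procedure below applied to $\phi(u)=\langle g,u\rangle+\frac\beta2\|u-x\|^2$ from $u_1=x$. Weak separation oracle $\mathrm{LOsep}_X(c,x,\Phi,\alpha)$: given $c\in\mathbb{R}^n$, $x\in X$, $\Phi>0$, $\alpha\ge1$, it returns a vertex (extreme point) $y\in X$ such that either (1) $c^T(x-y)>\Phi/\alpha$, or (2) $y\in\operatorname{argmax}_{z\in X}c^T(x-z)$ and $c^T(x-y)\le\Phi$. LCG procedure. Input: smooth convex $\phi$, $u_1\in X$, $\alpha\ge1$, $\eta$. Set $\Phi_0\leftarrow\max_{u\in X}\nabla\phi(u_1)^T(u_1-u)$. For $t=1,2,\dots$: let $v_t\leftarrow\mathrm{LOsep}_X(\nabla\phi(u_t),u_t,\Phi_{t-1},\alpha)$. If it is not the case that $\nabla\phi(u_t)^T(u_t-v_t)>\Phi_{t-1}/\alpha$, then: if $\Phi_{t-1}=\eta$, stop and return $u_t$; otherwise $\Phi_t\leftarrow\max\{\Phi_{t-1}/2,\eta\}$. (Otherwise $\Phi_t\leftarrow\Phi_{t-1}$.) Then choose $\lambda_t\in\operatorname{argmin}_{\lambda\in[0,1]}\phi((1-\lambda)u_t+\lambda v_t)$ and set $u_{t+1}\leftarrow(1-\lambda_t)u_t+\lambda_tv_t$.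
   Formalization: LCG's initial estimate Φ_0 is taken as the larger of max_u ⟨∇φ(u_1),u_1−u⟩ and η: the plain maximum can be 0, where LOsep is undefined, and for α>1 a tiny Φ_0<η can break the claimed bound on LOsep calls. ‖A‖, D_X and D_{Y,W} are assumed positive so that τ is defined. *)

theory Defs
  imports "HOL-Analysis.Analysis" "HOL-Library.While_Combinator"
begin

definition grad :: "('a::real_inner \<Rightarrow> real) \<Rightarrow> 'a \<Rightarrow> 'a" where
  "grad F x = (THE g. GDERIV F x :> g)"

definition eps_solution :: "'a set \<Rightarrow> ('a \<Rightarrow> real) \<Rightarrow> real \<Rightarrow> 'a \<Rightarrow> bool" where
  "eps_solution X f \<epsilon> x \<longleftrightarrow> x \<in> X \<and> f x - (INF u\<in>X. f u) \<le> \<epsilon>"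

definition saddle_obj ::
  "'b::real_inner set \<Rightarrow> ('a \<Rightarrow> 'b) \<Rightarrow> ('b \<Rightarrow> real) \<Rightarrow> 'a \<Rightarrow> real" where
  "saddle_obj Y A fhat x = (SUP y\<in>Y. A x \<bullet> y - fhat y)"

text \<open>The second argument of \<open>str_convex_diff\<close> and \<open>bregman\<close> is the gradient of the first one.  It is
  required to be a derivative within \<open>Y\<close> only, so that for lower-dimensional \<open>Y\<close> it is not
  unique; its inner products with differences of points of \<open>Y\<close>, which are all that is used, are.\<close>

definition str_convex_diff ::
  "('b::real_inner \<Rightarrow> real) \<Rightarrow> ('b \<Rightarrow> 'b) \<Rightarrow> real \<Rightarrow> 'b set \<Rightarrow> bool" where
  "str_convex_diff \<omega> \<omega>' \<sigma> Y \<longleftrightarrow>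
     0 < \<sigma> \<and>
     (\<forall>x\<in>Y. (\<omega> has_derivative (\<lambda>h. \<omega>' x \<bullet> h)) (at x within Y)) \<and>
     (\<forall>x\<in>Y. \<forall>y\<in>Y. \<omega> y \<ge> \<omega> x + \<omega>' x \<bullet> (y - x) + \<sigma> / 2 * (norm (y - x))\<^sup>2)"

definition bregman ::
  "('b::real_inner \<Rightarrow> real) \<Rightarrow> ('b \<Rightarrow> 'b) \<Rightarrow> 'b set \<Rightarrow> 'b \<Rightarrow> real" where
  "bregman \<omega> \<omega>' Y y =
     (let c = arg_min_on \<omega> Y in \<omega> y - \<omega> c - \<omega>' c \<bullet> (y - c))"

definition bregman_diam ::
  "('b::real_inner \<Rightarrow> real) \<Rightarrow> ('b \<Rightarrow> 'b) \<Rightarrow> 'b set \<Rightarrow> real" where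
  "bregman_diam \<omega> \<omega>' Y = sqrt (SUP y\<in>Y. bregman \<omega> \<omega>' Y y)"

definition smooth_integrand ::
  "'b::real_inner set \<Rightarrow> ('a \<Rightarrow> 'b) \<Rightarrow> ('b \<Rightarrow> real) \<Rightarrow> ('b \<Rightarrow> real) \<Rightarrow> ('b \<Rightarrow> 'b) \<Rightarrow> real \<Rightarrow> 'a \<Rightarrow> 'b \<Rightarrow> real" where
  "smooth_integrand Y A fhat \<omega> \<omega>' \<tau> x y =
     A x \<bullet> y - fhat y - \<tau> * (bregman \<omega> \<omega>' Y y - (bregman_diam \<omega> \<omega>' Y)\<^sup>2)"

definition smooth_obj ::
  "'b::real_inner set \<Rightarrow> ('a \<Rightarrow> 'b) \<Rightarrow> ('b \<Rightarrow> real) \<Rightarrow> ('b \<Rightarrow> real) \<Rightarrow> ('b \<Rightarrow> 'b) \<Rightarrow> real \<Rightarrow> 'a \<Rightarrow> real" where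
  "smooth_obj Y A fhat \<omega> \<omega>' \<tau> x = (SUP y\<in>Y. smooth_integrand Y A fhat \<omega> \<omega>' \<tau> x y)"

definition weak_separation_oracle ::
  "'a::real_inner set \<Rightarrow> ('a \<Rightarrow> 'a \<Rightarrow> real \<Rightarrow> real \<Rightarrow> 'a) \<Rightarrow> bool" where
  "weak_separation_oracle X LO \<longleftrightarrow>
     (\<forall>c. \<forall>x\<in>X. \<forall>\<Phi>>0. \<forall>\<alpha>\<ge>1.
        let y = LO c x \<Phi> \<alpha> in
          y extreme_point_of X \<and>
          (c \<bullet> (x - y) > \<Phi> / \<alpha> \<or>
           is_arg_max (\<lambda>z. c \<bullet> (x - z)) (\<lambda>z. z \<in> X) y \<and> c \<bullet> (x - y) \<le> \<Phi>))"

text \<open>The oracle may be lazy: its answer may depend on the earlier calls and on arbitrary internal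
  state.  We therefore let \<open>LO j\<close> answer the call that is preceded by exactly \<open>j\<close> calls.  As
  \<open>LO\<close> is an arbitrary family of weak separation oracles, this covers every sequence of valid
  answers.

  The loop state of \<open>lcg\<close> is \<open>(u\<^sub>t, \<Phi>\<^sub>t\<^sub>-\<^sub>1, j)\<close> at the start of pass \<open>t\<close>, where \<open>j\<close> counts
  the oracle calls made so far.  The result is the returned point with the updated count, in which
  the last call, the one in the pass that stops, is included; it is \<open>None\<close> if the loop does not
  terminate.  The exact line search is over a segment on which \<open>\<phi>\<close> is a strictly convex quadratic
  in the intended use, unless \<open>u = v\<close>; hence the choice of a minimizer has no influence on the
  next iterate.

  The initial gap estimate is bounded from below by \<open>\<eta>\<close>, as all later estimates are.  For
  \<open>\<eta> > 0\<close> this ensures that the oracle is called with a positive \<open>\<Phi>\<close> only, and it makes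
  \<open>\<Phi> = \<eta>\<close> the terminal estimate.  It differs from the bare maximum only if the starting point
  already meets the accuracy \<open>\<eta>\<close>; reducing a gap estimate far below \<open>\<eta>\<close> by the factor
  \<open>\<alpha>\<close> could then take a number of calls that is not bounded in terms of \<open>\<eta>\<close>.\<close>

definition lcg_stop ::
  "(nat \<Rightarrow> 'a \<Rightarrow> 'a \<Rightarrow> real \<Rightarrow> real \<Rightarrow> 'a) \<Rightarrow> ('a::real_inner \<Rightarrow> real) \<Rightarrow> real \<Rightarrow> real
     \<Rightarrow> 'a \<times> real \<times> nat \<Rightarrow> bool" where
  "lcg_stop LO \<phi> \<alpha> \<eta> = (\<lambda>(u, \<Phi>, j).
     let v = LO j (grad \<phi> u) u \<Phi> \<alpha>
     in \<not> grad \<phi> u \<bullet> (u - v) > \<Phi> / \<alpha> \<and> \<Phi> = \<eta>)"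

definition lcg_step ::
  "(nat \<Rightarrow> 'a \<Rightarrow> 'a \<Rightarrow> real \<Rightarrow> real \<Rightarrow> 'a) \<Rightarrow> ('a::real_inner \<Rightarrow> real) \<Rightarrow> real \<Rightarrow> real
     \<Rightarrow> 'a \<times> real \<times> nat \<Rightarrow> 'a \<times> real \<times> nat" where
  "lcg_step LO \<phi> \<alpha> \<eta> = (\<lambda>(u, \<Phi>, j).
     let v = LO j (grad \<phi> u) u \<Phi> \<alpha>;
         \<Phi>' = (if grad \<phi> u \<bullet> (u - v) > \<Phi> / \<alpha> then \<Phi> else max (\<Phi> / 2) \<eta>);
         l = arg_min_on (\<lambda>l. \<phi> ((1 - l) *\<^sub>R u + l *\<^sub>R v)) {0..1}
     in ((1 - l) *\<^sub>R u + l *\<^sub>R v, \<Phi>', Suc j))"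

definition lcg ::
  "'a::real_inner set \<Rightarrow> (nat \<Rightarrow> 'a \<Rightarrow> 'a \<Rightarrow> real \<Rightarrow> real \<Rightarrow> 'a) \<Rightarrow> ('a \<Rightarrow> real) \<Rightarrow> 'a
     \<Rightarrow> real \<Rightarrow> real \<Rightarrow> nat \<Rightarrow> ('a \<times> nat) option" where
  "lcg X LO \<phi> u\<^sub>1 \<alpha> \<eta> j =
     map_option (\<lambda>(u, \<Phi>, j'). (u, Suc j'))
       (while_option (\<lambda>s. \<not> lcg_stop LO \<phi> \<alpha> \<eta> s) (lcg_step LO \<phi> \<alpha> \<eta>)
          (u\<^sub>1, max (SUP u\<in>X. grad \<phi> u\<^sub>1 \<bullet> (u\<^sub>1 - u)) \<eta>, j))"

text \<open>\<open>calgd\<close> returns \<open>(x\<^sub>k, y\<^sub>k, a, j)\<close> after \<open>k\<close> outer iterations, where \<open>a\<close> counts the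
  evaluations of \<open>A\<close> and of its adjoint, and \<open>j\<close> counts the oracle calls.  The gradient of
  \<open>smooth_obj\<close> at \<open>z\<close> is the image under the adjoint of \<open>A\<close> of the maximizer belonging to
  \<open>A z\<close>, so one gradient costs two evaluations.  The gradients of the model
  function inside \<open>lcg\<close> reuse it and cost none.\<close>

fun calgd ::
  "'a::real_inner set \<Rightarrow> (nat \<Rightarrow> 'a \<Rightarrow> 'a \<Rightarrow> real \<Rightarrow> real \<Rightarrow> 'a) \<Rightarrow> (real \<Rightarrow> 'a \<Rightarrow> real)
     \<Rightarrow> real \<Rightarrow> (nat \<Rightarrow> real) \<Rightarrow> (nat \<Rightarrow> real) \<Rightarrow> (nat \<Rightarrow> real) \<Rightarrow> (nat \<Rightarrow> real) \<Rightarrow> 'a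
     \<Rightarrow> nat \<Rightarrow> ('a \<times> 'a \<times> nat \<times> nat) option" where
  "calgd X LO F \<alpha> \<beta> \<gamma> \<eta> \<tau> x\<^sub>0 0 = Some (x\<^sub>0, x\<^sub>0, 0, 0)"
| "calgd X LO F \<alpha> \<beta> \<gamma> \<eta> \<tau> x\<^sub>0 (Suc i) =
     (case calgd X LO F \<alpha> \<beta> \<gamma> \<eta> \<tau> x\<^sub>0 i of
        None \<Rightarrow> None
      | Some (x, y, a, j) \<Rightarrow>
         (let k = Suc i;
              z = (1 - \<gamma> k) *\<^sub>R y + \<gamma> k *\<^sub>R x;
              g = grad (F (\<tau> k)) z
          in case lcg X LO (\<lambda>u. g \<bullet> u + \<beta> k / 2 * (norm (u - x))\<^sup>2) x \<alpha> (\<eta> k) j of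
               None \<Rightarrow> None
             | Some (x', j') \<Rightarrow> Some (x', (1 - \<gamma> k) *\<^sub>R y + \<gamma> k *\<^sub>R x', a + 2, j')))"

text \<open>The constant hidden in the complexity bounds.  Only its independence of everything except
  \<open>\<alpha>\<close> matters, not its (generous) value.  It is fixed here because an existential quantifier
  inside a theorem that is polymorphic in the index types \<open>'n\<close> and \<open>'m\<close> would allow
  it to depend on the two dimensions.\<close>

definition calgd_const :: "real \<Rightarrow> real" where
  "calgd_const \<alpha> = 10000 * \<alpha>\<^sup>2"

end

theory Submission
  imports Defs
begin

text \<open>Smoothing.  Let \<open>y\<^sub>x\<close> be the maximizer defining \<open>f\<^sub>\<tau> x\<close>.  Comparing the integrands at \<open>y\<^sub>x\<close>
  and at \<open>y\<^sub>z\<close>, strong concavity in \<open>y\<close> gives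
  \<open>0 \<le> f\<^sub>\<tau> z - f\<^sub>\<tau> x - \<langle>A\<^sup>T y\<^sub>x, z - x\<rangle> \<le> \<parallel>A\<parallel>\<^sup>2 / (2 \<tau> \<sigma>) \<parallel>z - x\<parallel>\<^sup>2\<close>; this contains
  differentiability, the formula for the gradient and all the smoothness that is needed, and it
  shows that the gradients are bounded uniformly in \<open>\<tau>\<close>.

  Outer loop.  With \<open>w\<^sub>k = k (k + 1) (k + 2)\<close>, for which \<open>w\<^sub>k (1 - \<gamma>\<^sub>k) = w\<^sub>k\<^sub>-\<^sub>1\<close>, the usual estimate of
  an accelerated method telescopes to \<open>f\<^sub>\<tau> y\<^sub>N - f\<^sub>\<tau> u \<le> 21/2 L D\<^sup>2 / ((N + 1) (N + 2))\<close>.  The choice of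
  \<open>\<tau>\<close> makes this and the smoothing error \<open>\<tau> \<D>\<^sup>2\<close> of the order of \<open>Q / N\<close>, where
  \<open>Q = \<parallel>A\<parallel> D \<D> / \<surd>\<sigma>\<close>.

  Inner loop.  The primal gap is at most twice the gap estimate \<open>\<Phi>\<close>, and each positive oracle answer
  decreases it by a fixed amount \<open>d \<Phi>\<close>.  Hence the primal gap divided by \<open>d \<Phi>\<close>, plus a bound on
  the calls made after the next halving of \<open>\<Phi>\<close>, drops by one with every call.  Summed over the
  halvings this gives \<open>O(\<alpha> log (\<Phi>\<^sub>0 / \<eta>\<^sub>k) + \<alpha>\<^sup>2 \<beta>\<^sub>k D\<^sup>2 / \<eta>\<^sub>k)\<close> calls.  The second term is \<open>O(\<alpha>\<^sup>2 k)\<close>;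
  the first one, which depends on the data, is \<open>O(\<alpha> N)\<close> as soon as \<open>N\<close> is large, that is, as soon as
  \<open>\<epsilon>\<close> is small.\<close>

section \<open>Gradients of quadratic models and minimizers on compact sets\<close>

text \<open>A remainder of second order vanishes after division by the distance. This one criterion
  serves both the quadratic models of \<open>lcg\<close> and the smoothed objective, whose gradient
  is read off from a lower and an upper model.\<close>

lemma gderiv_of_quadratic_bound:
  fixes F :: "'a::real_inner \<Rightarrow> real"
  assumes "\<And>y. \<bar>F y - F x - g \<bullet> (y - x)\<bar> \<le> C * (norm (y - x))\<^sup>2"
  shows "GDERIV F x :> g"
  unfolding gderiv_def
proof (rule has_derivativeI_sandwich[where e = 1 and H = "\<lambda>y. C * norm (y - x)"])
  show "bounded_linear (\<lambda>h. h \<bullet> g)"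
    by (rule bounded_linear_inner_left)
  show "norm (F y - F x - (y - x) \<bullet> g) / norm (y - x) \<le> C * norm (y - x)" if "y \<noteq> x" for y
    using assms[of y] that by (simp add: divide_le_eq power2_eq_square inner_commute mult.assoc)
  show "((\<lambda>y. C * norm (y - x)) \<longlongrightarrow> 0) (at x)"
    by (auto intro!: tendsto_eq_intros)
qed simp

lemma grad_eqI:
  assumes "GDERIV F x :> g"
  shows "grad F x = g"
  unfolding grad_def
proof (rule the_equality[of "\<lambda>g. GDERIV F x :> g", OF assms])
  fix g' assume "GDERIV F x :> g'"
  hence "(\<lambda>h. h \<bullet> g') = (\<lambda>h. h \<bullet> g)"
    using assms unfolding gderiv_def by (rule has_derivative_unique)
  hence "(g' - g) \<bullet> g' = (g' - g) \<bullet> g"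
    by metis
  hence "(g' - g) \<bullet> (g' - g) = 0"
    by (simp add: inner_diff_right)
  thus "g' = g" by simp
qed

text \<open>A quadratic has no remainder beyond second order. The identity yields the gradient of
  the model, its convexity (drop the last term) and its exact values along a search segment.\<close>

lemma quadratic_expansion:
  fixes g x u w :: "'a::real_inner"
  shows "g \<bullet> w + \<beta> / 2 * (norm (w - x))\<^sup>2 =
    g \<bullet> u + \<beta> / 2 * (norm (u - x))\<^sup>2 + (g + \<beta> *\<^sub>R (u - x)) \<bullet> (w - u) + \<beta> / 2 * (norm (w - u))\<^sup>2"
  unfolding power2_norm_eq_inner
  by (simp add: inner_diff_left inner_diff_right inner_add_left inner_commute algebra_simps)

lemma grad_quadratic:
  fixes g x u :: "'a::real_inner"
  shows "grad (\<lambda>u. g \<bullet> u + \<beta> / 2 * (norm (u - x))\<^sup>2) u = g + \<beta> *\<^sub>R (u - x)"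
  by (rule grad_eqI, rule gderiv_of_quadratic_bound[where C = "\<bar>\<beta>\<bar> / 2"],
      subst quadratic_expansion[of _ _ _ _ u]) (simp add: abs_mult)

lemma arg_min_on_compact:
  fixes f :: "'a::topological_space \<Rightarrow> real"
  assumes "compact S" "S \<noteq> {}" "continuous_on S f"
  shows "arg_min_on f S \<in> S" "\<And>x. x \<in> S \<Longrightarrow> f (arg_min_on f S) \<le> f x"
proof -
  obtain m where "m \<in> S" "\<forall>x\<in>S. f m \<le> f x"
    using continuous_attains_inf[OF assms] by blast
  hence "is_arg_min f (\<lambda>x. x \<in> S) m"
    by (auto simp: is_arg_min_linorder)
  hence "is_arg_min f (\<lambda>x. x \<in> S) (arg_min_on f S)"
    unfolding arg_min_on_def arg_min_def by (rule someI)
  thus "arg_min_on f S \<in> S" "\<And>x. x \<in> S \<Longrightarrow> f (arg_min_on f S) \<le> f x"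
    by (auto simp: is_arg_min_linorder)
qed

section \<open>Inner loop: counting the oracle calls of \<open>lcg\<close>\<close>

text \<open>With \<open>K = \<beta> D\<^sup>2\<close>, exact line search in the direction of an answer with gap above \<open>\<Phi> / \<alpha>\<close>
  decreases the model by at least \<open>phase_decrease\<close>.  In \<open>later_calls\<close>, the terms in \<open>K\<close> come from the
  geometric sum of \<open>4 \<alpha>\<^sup>2 K / \<Phi>\<close> over the successive estimates; the constant 12 instead of 8 pays for
  the last reduction, from some \<open>\<Phi> < 2 \<eta>\<close> to \<open>\<eta>\<close>, which may be less than a halving.\<close>

definition phase_decrease :: "real \<Rightarrow> real \<Rightarrow> real \<Rightarrow> real" where
  "phase_decrease \<alpha> K \<Phi> = min (\<Phi> / (2 * \<alpha>)) (\<Phi>\<^sup>2 / (2 * \<alpha>\<^sup>2 * K))"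

definition later_calls :: "real \<Rightarrow> real \<Rightarrow> real \<Rightarrow> real \<Rightarrow> real" where
  "later_calls \<alpha> K \<eta> \<Phi> =
     (if \<Phi> \<le> \<eta> then 0
      else (4 * \<alpha> + 1) * (log 2 (\<Phi> / \<eta>) + 1) + 12 * \<alpha>\<^sup>2 * K / \<eta> - 8 * \<alpha>\<^sup>2 * K / \<Phi>)"

lemma phase_decrease_pos:
  assumes "\<alpha> \<ge> 1" "K > 0" "\<Phi> > 0"
  shows "phase_decrease \<alpha> K \<Phi> > 0"
  using assms by (simp add: phase_decrease_def)

text \<open>Each positive answer lowers the primal gap h by at least \<open>phase_decrease\<close>,
  so the quotient bounds the positive answers at one estimate \<Phi>. The two summands come from the
  two cases of the minimum.\<close>

lemma phase_calls_le:
  assumes "\<alpha> \<ge> 1" "K > 0" "\<Phi> > 0" "h \<le> 2 * \<Phi>"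
  shows "h / phase_decrease \<alpha> K \<Phi> \<le> 4 * \<alpha> + 4 * \<alpha>\<^sup>2 * K / \<Phi>"
proof -
  have "h / phase_decrease \<alpha> K \<Phi> \<le> 2 * \<Phi> / phase_decrease \<alpha> K \<Phi>"
    using assms phase_decrease_pos[of \<alpha> K \<Phi>] by (simp add: divide_right_mono)
  also have "\<dots> \<le> 4 * \<alpha> + 4 * \<alpha>\<^sup>2 * K / \<Phi>"
  proof (cases "\<Phi> / (2 * \<alpha>) \<le> \<Phi>\<^sup>2 / (2 * \<alpha>\<^sup>2 * K)")
    case True
    hence "2 * \<Phi> / phase_decrease \<alpha> K \<Phi> = 4 * \<alpha>"
      using assms by (simp add: phase_decrease_def min_def field_simps)
    thus ?thesis using assms by simp
  next
    case False
    hence "2 * \<Phi> / phase_decrease \<alpha> K \<Phi> = 4 * \<alpha>\<^sup>2 * K / \<Phi>"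
      using assms by (simp add: phase_decrease_def min_def power2_eq_square field_simps)
    thus ?thesis using assms by simp
  qed
  finally show ?thesis .
qed

text \<open>The budget at \<Phi> pays for the negative answer itself, for the positive answers at
  the new estimate and for all that follows. In an exact halving the logarithm drops by one,
  releasing 4 \<alpha> + 1, and the change of the term in K / \<Phi> releases the rest. In the cut
  at \<eta> the constants suffice, since 12 - 8 = 4.\<close>

lemma later_calls_halve:
  assumes "\<alpha> \<ge> 1" "K > 0" "\<eta> > 0" "\<eta> < \<Phi>"
  defines "\<Phi>' \<equiv> max (\<Phi> / 2) \<eta>"
  shows "later_calls \<alpha> K \<eta> \<Phi>' + (4 * \<alpha> + 4 * \<alpha>\<^sup>2 * K / \<Phi>') + 1 \<le> later_calls \<alpha> K \<eta> \<Phi>"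
proof (cases "\<Phi> / 2 \<le> \<eta>")
  case True
  have "log 2 (\<Phi> / \<eta>) \<ge> 0"
    using assms by simp
  hence "4 * \<alpha> + 1 \<le> (4 * \<alpha> + 1) * (log 2 (\<Phi> / \<eta>) + 1)"
    using assms by simp
  moreover have "8 * \<alpha>\<^sup>2 * K / \<Phi> \<le> 8 * \<alpha>\<^sup>2 * K / \<eta>"
    using assms by (intro divide_left_mono) auto
  moreover have "12 * \<alpha>\<^sup>2 * K / \<eta> = 4 * \<alpha>\<^sup>2 * K / \<eta> + 8 * \<alpha>\<^sup>2 * K / \<eta>"
    by (simp add: add_divide_distrib[symmetric])
  moreover have "\<Phi>' = \<eta>"
    using True by (simp add: \<Phi>'_def)
  moreover have "later_calls \<alpha> K \<eta> \<eta> = 0" "later_calls \<alpha> K \<eta> \<Phi> =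
      (4 * \<alpha> + 1) * (log 2 (\<Phi> / \<eta>) + 1) + 12 * \<alpha>\<^sup>2 * K / \<eta> - 8 * \<alpha>\<^sup>2 * K / \<Phi>"
    using assms(4) by (simp_all add: later_calls_def)
  ultimately show ?thesis
    by simp
next
  case False
  have "log 2 (\<Phi> / 2 / \<eta>) = log 2 (\<Phi> / \<eta>) - 1"
    using assms by (simp add: log_divide log_mult)
  thus ?thesis
    using False assms by (simp add: later_calls_def max_def field_simps)
qed

lemma later_calls_le:
  assumes "\<alpha> \<ge> 1" "K > 0" "\<eta> > 0" "\<eta> \<le> \<Phi>"
  shows "later_calls \<alpha> K \<eta> \<Phi> \<le> (4 * \<alpha> + 1) * (log 2 (\<Phi> / \<eta>) + 1) + 12 * \<alpha>\<^sup>2 * K / \<eta>"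
  using assms by (simp add: later_calls_def)

lemma later_calls_nonneg:
  assumes "\<alpha> \<ge> 1" "K > 0" "\<eta> > 0" "\<eta> \<le> \<Phi>"
  shows "0 \<le> later_calls \<alpha> K \<eta> \<Phi>"
proof (cases "\<Phi> \<le> \<eta>")
  case False
  have "8 * \<alpha>\<^sup>2 * K / \<Phi> \<le> 12 * \<alpha>\<^sup>2 * K / \<eta>"
    using assms by (intro frac_le) auto
  moreover have "0 \<le> (4 * \<alpha> + 1) * (log 2 (\<Phi> / \<eta>) + 1)"
    using assms False by (intro mult_nonneg_nonneg add_nonneg_nonneg) auto
  ultimately show ?thesis using False by (simp add: later_calls_def)
qed (simp add: later_calls_def)

text \<open>With s = \<Phi> / \<alpha> and K = \<beta> D^2 the left side is at most - l s + l^2 K /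
  2. Its minimizer l = s / K gives the decrease s^2 / (2 K) and is admissible if s < K; otherwise l
  = 1 gives at least s / 2.\<close>

lemma line_search_decrease:
  assumes "\<alpha> \<ge> 1" "\<beta> > 0" "D > 0" "\<Phi> > 0" "\<Phi> / \<alpha> < \<delta>" "0 \<le> r" "r \<le> D"
  obtains l where "0 \<le> l" "l \<le> 1"
    "- l * \<delta> + \<beta> / 2 * (l * r)\<^sup>2 \<le> - phase_decrease \<alpha> (\<beta> * D\<^sup>2) \<Phi>"
proof -
  define s K where "s = \<Phi> / \<alpha>" and "K = \<beta> * D\<^sup>2"
  have s: "s > 0" and K: "K > 0" and "s < \<delta>"
    using assms by (simp_all add: s_def K_def)
  have d: "phase_decrease \<alpha> K \<Phi> = min (s / 2) (s\<^sup>2 / (2 * K))"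
    using assms by (simp add: phase_decrease_def s_def power_divide field_simps)
  have upper: "- l * \<delta> + \<beta> / 2 * (l * r)\<^sup>2 \<le> - l * s + l\<^sup>2 * K / 2" if "0 \<le> l" for l
  proof -
    have "l * s \<le> l * \<delta>" using that \<open>s < \<delta>\<close> by (simp add: mult_left_mono)
    moreover have "(l * r)\<^sup>2 \<le> (l * D)\<^sup>2"
      using that assms by (intro power_mono mult_left_mono) auto
    hence "\<beta> / 2 * (l * r)\<^sup>2 \<le> \<beta> / 2 * (l * D)\<^sup>2"
      using assms by (intro mult_left_mono) auto
    ultimately show ?thesis by (simp add: K_def power_mult_distrib algebra_simps)
  qed
  show ?thesis
  proof (cases "s \<ge> K")
    case True
    have "- 1 * \<delta> + \<beta> / 2 * (1 * r)\<^sup>2 \<le> - (s / 2)"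
      using upper[of 1] True by simp
    also have "\<dots> \<le> - phase_decrease \<alpha> K \<Phi>"
      by (simp add: d)
    finally show ?thesis by (intro that[of 1]) (auto simp: K_def)
  next
    case False
    have "- (s / K) * \<delta> + \<beta> / 2 * (s / K * r)\<^sup>2 \<le> - (s / K) * s + (s / K)\<^sup>2 * K / 2"
      using s K by (intro upper) auto
    also have "\<dots> = - (s\<^sup>2 / (2 * K))"
      using K by (simp add: field_simps power2_eq_square)
    also have "\<dots> \<le> - phase_decrease \<alpha> K \<Phi>"
      by (simp add: d)
    finally show ?thesis
      using s K False by (intro that[of "s / K"]) (auto simp: K_def)
  qed
qed

lemma weak_separation_oracleD:
  assumes "weak_separation_oracle X LO" "x \<in> X" "\<Phi> > 0" "\<alpha> \<ge> 1"
  shows "LO c x \<Phi> \<alpha> \<in> X"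
    and "\<not> \<Phi> / \<alpha> < c \<bullet> (x - LO c x \<Phi> \<alpha>) \<Longrightarrow> z \<in> X \<Longrightarrow> c \<bullet> (x - z) \<le> \<Phi>"
  using assms unfolding weak_separation_oracle_def Let_def is_arg_max_linorder extreme_point_of_def
  by (blast, meson order_trans)

text \<open>The returned point has Frank-Wolfe gap at most \<eta>, which is the inexact optimality
  condition used by the outer loop. \<Gamma> is any bound on the initial gap and enters only through
  the logarithm, which counts the halvings.\<close>

lemma lcg_bound:
  fixes X :: "'a::euclidean_space set"
  assumes "convex X" "compact X" "x \<in> X"
    and D: "D > 0" "\<And>u v. u \<in> X \<Longrightarrow> v \<in> X \<Longrightarrow> norm (u - v) \<le> D"
    and pos: "\<beta> > 0" "\<eta> > 0" "\<alpha> \<ge> 1"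
    and sep: "\<And>j. weak_separation_oracle X (LO j)"
    and gap: "\<And>u. u \<in> X \<Longrightarrow> g \<bullet> (x - u) \<le> \<Gamma>" "\<eta> \<le> \<Gamma>"
  shows "\<exists>u j'. lcg X LO (\<lambda>u. g \<bullet> u + \<beta> / 2 * (norm (u - x))\<^sup>2) x \<alpha> \<eta> j = Some (u, j') \<and> u \<in> X \<and>
    (\<forall>w\<in>X. (g + \<beta> *\<^sub>R (u - x)) \<bullet> (u - w) \<le> \<eta>) \<and>
    real j' \<le> real j + (10 * \<alpha> + 5 * \<alpha> * log 2 (\<Gamma> / \<eta>) + 16 * \<alpha>\<^sup>2 * (\<beta> * D\<^sup>2) / \<eta>)"
proof -
  define \<phi> where "\<phi> = (\<lambda>u. g \<bullet> u + \<beta> / 2 * (norm (u - x))\<^sup>2)"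
  define G where "G u = g + \<beta> *\<^sub>R (u - x)" for u
  have grad: "grad \<phi> u = G u" for u
    unfolding \<phi>_def G_def by (rule grad_quadratic)
  have expand: "\<phi> w = \<phi> u + G u \<bullet> (w - u) + \<beta> / 2 * (norm (w - u))\<^sup>2" for u w
    unfolding \<phi>_def G_def by (rule quadratic_expansion)
  have cont: "continuous_on S \<phi>" for S
    unfolding \<phi>_def by (intro continuous_intros)
  obtain m where m: "m \<in> X" "\<And>u. u \<in> X \<Longrightarrow> \<phi> m \<le> \<phi> u"
    using continuous_attains_inf[OF \<open>compact X\<close> _ cont] \<open>x \<in> X\<close> by blast
  define K where "K = \<beta> * D\<^sup>2"
  have "K > 0" using pos D by (simp add: K_def)
  define d where "d = phase_decrease \<alpha> K"
  define S where "S = later_calls \<alpha> K \<eta>"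
  \<comment> \<open>Potential: the first summand bounds the positive answers still possible at the
    current estimate, the second all calls from the next negative answer on, except the final one
    that stops the loop.\<close>
  define R where "R u \<Phi> = (\<phi> u - \<phi> m) / d \<Phi> + S \<Phi>" for u \<Phi>
  have d_pos: "d \<Phi> > 0" if "\<eta> \<le> \<Phi>" for \<Phi>
    using that pos \<open>K > 0\<close> by (simp add: d_def phase_decrease_pos)
  have R_nonneg: "R u \<Phi> \<ge> 0" if "\<eta> \<le> \<Phi>" "u \<in> X" for u \<Phi>
    using that pos \<open>K > 0\<close> m d_pos[of \<Phi>]
    by (auto simp: R_def S_def intro!: add_nonneg_nonneg later_calls_nonneg divide_nonneg_nonneg)
  define \<Phi>\<^sub>0 where "\<Phi>\<^sub>0 = max (SUP u\<in>X. grad \<phi> x \<bullet> (x - u)) \<eta>"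
  define B where "B = real j + R x \<Phi>\<^sub>0"
  \<comment> \<open>Calls made plus potential never exceed the initial value \<open>B\<close>. The
    factor 2 allows for the halving of an estimate that bounds the primal gap.\<close>
  define P where "P = (\<lambda>(u, \<Phi>, i). u \<in> X \<and> \<eta> \<le> \<Phi> \<and> \<phi> u - \<phi> m \<le> 2 * \<Phi> \<and> real i + R u \<Phi> \<le> B)"
  have step: "P (lcg_step LO \<phi> \<alpha> \<eta> s)" if "P s" and running: "\<not> lcg_stop LO \<phi> \<alpha> \<eta> s" for s
  proof -
    obtain u \<Phi> i where s: "s = (u, \<Phi>, i)" by (cases s)
    have u: "u \<in> X" "\<eta> \<le> \<Phi>" "\<phi> u - \<phi> m \<le> 2 * \<Phi>" "real i + R u \<Phi> \<le> B"
      using \<open>P s\<close> by (auto simp: P_def s)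
    have "\<Phi> > 0" using u pos by simp
    define v where "v = LO i (G u) u \<Phi> \<alpha>"
    have v: "v \<in> X"
      using weak_separation_oracleD(1)[OF sep u(1) \<open>\<Phi> > 0\<close> pos(3)] by (simp add: v_def)
    define \<Phi>' where "\<Phi>' = (if G u \<bullet> (u - v) > \<Phi> / \<alpha> then \<Phi> else max (\<Phi> / 2) \<eta>)"
    define \<psi> where "\<psi> = (\<lambda>l. \<phi> ((1 - l) *\<^sub>R u + l *\<^sub>R v))"
    define l where "l = arg_min_on \<psi> {0..1}"
    define u' where "u' = (1 - l) *\<^sub>R u + l *\<^sub>R v"
    have s': "lcg_step LO \<phi> \<alpha> \<eta> s = (u', \<Phi>', Suc i)"
      by (simp add: s lcg_step_def Let_def grad v_def \<Phi>'_def \<psi>_def l_def u'_def)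
    have "continuous_on {0..1} \<psi>"
      unfolding \<psi>_def \<phi>_def by (intro continuous_intros)
    hence l: "l \<in> {0..1}" "\<And>t. t \<in> {0..1} \<Longrightarrow> \<phi> u' \<le> \<psi> t"
      using arg_min_on_compact[of "{0..1}" \<psi>] by (auto simp: l_def \<psi>_def u'_def)
    have u': "u' \<in> X"
      using convexD_alt[OF \<open>convex X\<close> u(1) v] l by (auto simp: u'_def)
    have \<phi>u': "\<phi> u' \<le> \<phi> u"
      using l(2)[of 0] by (simp add: \<psi>_def)
    have "\<eta> \<le> \<Phi>'" using u by (auto simp: \<Phi>'_def)
    have "\<phi> u' - \<phi> m \<le> 2 * \<Phi>' \<and> R u' \<Phi>' + 1 \<le> R u \<Phi>"
    proof (cases "G u \<bullet> (u - v) > \<Phi> / \<alpha>")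
      case True
      hence "\<Phi>' = \<Phi>" by (simp add: \<Phi>'_def)
      \<comment> \<open>Some step length t achieves the decrease; the exact line search does at
        least as well.\<close>
      obtain t where t: "0 \<le> t" "t \<le> 1"
        "- t * (G u \<bullet> (u - v)) + \<beta> / 2 * (t * norm (v - u))\<^sup>2 \<le> - d \<Phi>"
        using line_search_decrease[OF pos(3,1) D(1) \<open>\<Phi> > 0\<close> True norm_ge_zero D(2)[OF v u(1)]]
        unfolding d_def K_def by metis
      have "\<psi> t = \<phi> u + G u \<bullet> (t *\<^sub>R (v - u)) + \<beta> / 2 * (norm (t *\<^sub>R (v - u)))\<^sup>2"
        unfolding \<psi>_def by (subst expand[of _ u]) (simp add: algebra_simps)
      also have "\<dots> = \<phi> u - t * (G u \<bullet> (u - v)) + \<beta> / 2 * (t * norm (v - u))\<^sup>2"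
        using t by (simp add: inner_diff_right right_diff_distrib)
      finally have "\<phi> u' \<le> \<phi> u - d \<Phi>"
        using l(2)[of t] t by simp
      hence "(\<phi> u' - \<phi> m) / d \<Phi> \<le> (\<phi> u - \<phi> m - d \<Phi>) / d \<Phi>"
        using d_pos[OF u(2)] by (intro divide_right_mono) auto
      also have "\<dots> = (\<phi> u - \<phi> m) / d \<Phi> - 1"
        using d_pos[OF u(2)] by (simp add: diff_divide_distrib)
      finally show ?thesis
        using \<phi>u' u(3) \<open>\<Phi>' = \<Phi>\<close> by (simp add: R_def)
    next
      case False
      hence \<Phi>': "\<Phi>' = max (\<Phi> / 2) \<eta>" by (simp add: \<Phi>'_def)
      have "\<Phi> \<noteq> \<eta>"
        using running False by (auto simp: s lcg_stop_def Let_def grad v_def)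
      hence "\<eta> < \<Phi>" using u by simp
      \<comment> \<open>A negative answer certifies the linearized gap at all points of X, in
        particular at the minimizer m. By convexity the primal gap is then at most \<Phi>, hence at
        most twice the new estimate.\<close>
      have "G u \<bullet> (u - m) \<le> \<Phi>"
        using weak_separation_oracleD(2)[OF sep u(1) \<open>\<Phi> > 0\<close> pos(3) _ m(1)] False
        by (simp add: v_def)
      moreover have "\<phi> u - \<phi> m \<le> G u \<bullet> (u - m)"
        using expand[of m u] pos by (simp add: inner_diff_right)
      ultimately have h: "\<phi> u' - \<phi> m \<le> 2 * \<Phi>'"
        using \<phi>u' by (simp add: \<Phi>')
      have "R u' \<Phi>' + 1 \<le> S \<Phi>"
        using phase_calls_le[OF pos(3) \<open>K > 0\<close> less_le_trans[OF pos(2) \<open>\<eta> \<le> \<Phi>'\<close>] h]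
          later_calls_halve[OF pos(3) \<open>K > 0\<close> pos(2) \<open>\<eta> < \<Phi>\<close>]
        unfolding R_def d_def S_def \<Phi>'[symmetric] by linarith
      moreover have "S \<Phi> \<le> R u \<Phi>"
        using m(2)[OF u(1)] d_pos[OF u(2)] by (simp add: R_def)
      ultimately show ?thesis using h by simp
    qed
    thus ?thesis
      using u' \<open>\<eta> \<le> \<Phi>'\<close> u(4) by (simp add: s' P_def)
  qed
  have bdd: "bdd_above ((\<lambda>u. grad \<phi> x \<bullet> (x - u)) ` X)"
    unfolding bdd_above_def using gap by (auto simp: grad G_def)
  have \<Phi>\<^sub>0: "\<eta> \<le> \<Phi>\<^sub>0" "\<Phi>\<^sub>0 \<le> \<Gamma>"
    using gap \<open>x \<in> X\<close> by (auto simp: \<Phi>\<^sub>0_def grad G_def intro!: cSUP_least)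
  have "grad \<phi> x \<bullet> (x - m) \<le> \<Phi>\<^sub>0"
    using cSUP_upper[OF m(1) bdd] by (simp add: \<Phi>\<^sub>0_def)
  moreover have "\<phi> x - \<phi> m \<le> grad \<phi> x \<bullet> (x - m)"
    using expand[of m x] pos by (simp add: grad inner_diff_right)
  ultimately have h0: "\<phi> x - \<phi> m \<le> 2 * \<Phi>\<^sub>0"
    using \<Phi>\<^sub>0 pos by linarith
  hence init: "P (x, \<Phi>\<^sub>0, j)"
    using \<Phi>\<^sub>0 \<open>x \<in> X\<close> by (simp add: P_def B_def)
  \<comment> \<open>Every pass raises the call count by one, while the invariant and
    \<open>R_nonneg\<close> keep it at most \<open>B\<close>; this forces termination.\<close>
  define \<mu> where "\<mu> = (\<lambda>(u::'a, \<Phi>::real, i). nat \<lfloor>B\<rfloor> - i)"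
  have "\<mu> (lcg_step LO \<phi> \<alpha> \<eta> s) < \<mu> s" if "P s" "\<not> lcg_stop LO \<phi> \<alpha> \<eta> s" for s
  proof -
    obtain u \<Phi> i where s: "s = (u, \<Phi>, i)" by (cases s)
    obtain u' \<Phi>' where s': "lcg_step LO \<phi> \<alpha> \<eta> s = (u', \<Phi>', Suc i)"
      by (simp add: s lcg_step_def Let_def)
    have "real (Suc i) \<le> B"
      using step[OF that] R_nonneg[of \<Phi>' u'] by (auto simp: s' P_def)
    hence "Suc i \<le> nat \<lfloor>B\<rfloor>" by (simp add: le_nat_floor)
    thus ?thesis by (simp add: s' \<mu>_def) (simp add: s)
  qed
  then obtain t where t: "while_option (\<lambda>s. \<not> lcg_stop LO \<phi> \<alpha> \<eta> s) (lcg_step LO \<phi> \<alpha> \<eta>) (x, \<Phi>\<^sub>0, j) = Some t"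
    using measure_while_option_Some[of P "\<lambda>s. \<not> lcg_stop LO \<phi> \<alpha> \<eta> s" "lcg_step LO \<phi> \<alpha> \<eta>" \<mu>] step init
    by blast
  obtain u \<Phi> i where tu: "t = (u, \<Phi>, i)" by (cases t)
  have "P t"
    using while_option_rule[of P, OF _ t init] step by blast
  hence u: "u \<in> X" "\<eta> \<le> \<Phi>" "real i + R u \<Phi> \<le> B"
    by (auto simp: P_def tu)
  have "lcg_stop LO \<phi> \<alpha> \<eta> t"
    using while_option_stop[OF t] by simp
  hence stop: "\<Phi> = \<eta>" "\<not> \<eta> / \<alpha> < G u \<bullet> (u - LO i (G u) u \<eta> \<alpha>)"
    by (auto simp: lcg_stop_def tu Let_def grad)
  have "G u \<bullet> (u - w) \<le> \<eta>" if "w \<in> X" for w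
    by (rule weak_separation_oracleD(2)[OF sep u(1) pos(2,3) stop(2) that])
  moreover have "lcg X LO \<phi> x \<alpha> \<eta> j = Some (u, Suc i)"
    using t by (simp add: lcg_def \<Phi>\<^sub>0_def tu)
  \<comment> \<open>The first phase contributes 4 \<alpha> and 4 \<alpha>^2 K / \<eta>, the later
    ones the rest. The call in the stopping pass is not counted by i; it turns 9 \<alpha> into 10
    \<alpha>.\<close>
  moreover have "real (Suc i) \<le> real j + (10 * \<alpha> + 5 * \<alpha> * log 2 (\<Gamma> / \<eta>) + 16 * \<alpha>\<^sup>2 * K / \<eta>)"
  proof -
    have "real i \<le> real j + R x \<Phi>\<^sub>0"
      using u R_nonneg[OF u(2,1)] by (simp add: B_def)
    also have "R x \<Phi>\<^sub>0 \<le> 4 * \<alpha> + 4 * \<alpha>\<^sup>2 * K / \<Phi>\<^sub>0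
        + ((4 * \<alpha> + 1) * (log 2 (\<Phi>\<^sub>0 / \<eta>) + 1) + 12 * \<alpha>\<^sup>2 * K / \<eta>)"
      unfolding R_def d_def S_def using \<Phi>\<^sub>0 pos \<open>K > 0\<close> h0
      by (intro add_mono phase_calls_le later_calls_le) auto
    also have "4 * \<alpha>\<^sup>2 * K / \<Phi>\<^sub>0 \<le> 4 * \<alpha>\<^sup>2 * K / \<eta>"
      using \<Phi>\<^sub>0 pos \<open>K > 0\<close> by (intro divide_left_mono) auto
    also have "(4 * \<alpha> + 1) * (log 2 (\<Phi>\<^sub>0 / \<eta>) + 1) \<le> 5 * \<alpha> * (log 2 (\<Gamma> / \<eta>) + 1)"
    proof (rule mult_mono)
      have log: "0 \<le> log 2 (\<Phi>\<^sub>0 / \<eta>)" "log 2 (\<Phi>\<^sub>0 / \<eta>) \<le> log 2 (\<Gamma> / \<eta>)"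
        using \<Phi>\<^sub>0 pos by (auto intro!: log_mono divide_right_mono)
      thus "log 2 (\<Phi>\<^sub>0 / \<eta>) + 1 \<le> log 2 (\<Gamma> / \<eta>) + 1" "0 \<le> log 2 (\<Phi>\<^sub>0 / \<eta>) + 1"
        by auto
    qed (use pos in auto)
    also have "real j + (4 * \<alpha> + 4 * \<alpha>\<^sup>2 * K / \<eta> + (5 * \<alpha> * (log 2 (\<Gamma> / \<eta>) + 1)
        + 12 * \<alpha>\<^sup>2 * K / \<eta>)) = real j + (9 * \<alpha> + 5 * \<alpha> * log 2 (\<Gamma> / \<eta>) + 16 * \<alpha>\<^sup>2 * K / \<eta>)"
      using pos by (simp add: field_simps)
    finally show ?thesis
      using pos by simp
  qed
  ultimately show ?thesis
    using u(1) unfolding \<phi>_def G_def K_def by blast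
qed

section \<open>Outer loop: one accelerated step and the telescoped potential\<close>

text \<open>The upper model is taken at the new point, the lower model at y with weight 1 - \<gamma>
  and at u with weight \<gamma>. The inexact optimality of x' and the three-point identity for
  squared norms bound the remaining inner product; their term in |x' - x|^2 absorbs the smoothness
  error because L \<gamma> \<le> \<beta>.\<close>

lemma calgd_outer_step:
  fixes F :: "'a::real_inner \<Rightarrow> real"
  assumes G: "\<And>z z'. F z + G z \<bullet> (z' - z) \<le> F z'"
      "\<And>z z'. F z' \<le> F z + G z \<bullet> (z' - z) + L / 2 * (norm (z' - z))\<^sup>2"
    and \<gamma>: "0 \<le> \<gamma>" "\<gamma> \<le> 1" "L * \<gamma> \<le> \<beta>"
    and z: "z = (1 - \<gamma>) *\<^sub>R y + \<gamma> *\<^sub>R x"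
    and gap: "(G z + \<beta> *\<^sub>R (x' - x)) \<bullet> (x' - u) \<le> \<eta>"
  shows "F ((1 - \<gamma>) *\<^sub>R y + \<gamma> *\<^sub>R x') - F u \<le> (1 - \<gamma>) * (F y - F u) + \<gamma> * \<eta>
    + \<beta> * \<gamma> / 2 * ((norm (x - u))\<^sup>2 - (norm (x' - u))\<^sup>2)"
proof -
  define y' where "y' = (1 - \<gamma>) *\<^sub>R y + \<gamma> *\<^sub>R x'"
  have diff: "y' - z = \<gamma> *\<^sub>R (x' - x)"
    by (simp add: y'_def z algebra_simps)
  have split: "G z \<bullet> (y' - z) =
      (1 - \<gamma>) * (G z \<bullet> (y - z)) + \<gamma> * (G z \<bullet> (u - z)) + \<gamma> * (G z \<bullet> (x' - u))"
    by (simp add: y'_def algebra_simps inner_diff_right inner_add_right)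
  have "(1 - \<gamma>) * (F z + G z \<bullet> (y - z)) \<le> (1 - \<gamma>) * F y"
    using G(1)[of z y] \<gamma> by (intro mult_left_mono) auto
  moreover have "\<gamma> * (F z + G z \<bullet> (u - z)) \<le> \<gamma> * F u"
    using G(1)[of z u] \<gamma> by (intro mult_left_mono) auto
  moreover have "\<gamma> * (G z \<bullet> (x' - u)) \<le>
      \<gamma> * (\<eta> + \<beta> / 2 * ((norm (x - u))\<^sup>2 - (norm (x' - u))\<^sup>2 - (norm (x' - x))\<^sup>2))"
  proof (intro mult_left_mono \<gamma>)
    have "2 * ((x' - x) \<bullet> (x' - u)) = (norm (x' - x))\<^sup>2 + (norm (x' - u))\<^sup>2 - (norm (x - u))\<^sup>2"
      unfolding power2_norm_eq_inner
      by (simp add: inner_diff_left inner_diff_right inner_commute)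
    hence "\<beta> * ((x' - x) \<bullet> (x' - u)) =
        \<beta> / 2 * ((norm (x' - x))\<^sup>2 + (norm (x' - u))\<^sup>2 - (norm (x - u))\<^sup>2)"
      by (metis mult.assoc nonzero_mult_div_cancel_right times_divide_eq_left zero_neq_numeral)
    thus "G z \<bullet> (x' - u) \<le> \<eta> + \<beta> / 2 * ((norm (x - u))\<^sup>2 - (norm (x' - u))\<^sup>2 - (norm (x' - x))\<^sup>2)"
      using gap by (simp add: inner_add_left algebra_simps)
  qed
  moreover have "F y' \<le> F z + G z \<bullet> (y' - z) + L / 2 * (\<gamma>\<^sup>2 * (norm (x' - x))\<^sup>2)"
    using G(2)[of y' z] \<gamma> by (simp add: diff power_mult_distrib)
  moreover have "L / 2 * (\<gamma>\<^sup>2 * (norm (x' - x))\<^sup>2) \<le> \<gamma> * \<beta> / 2 * (norm (x' - x))\<^sup>2"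
  proof -
    have "(L * \<gamma>) * (\<gamma> * (norm (x' - x))\<^sup>2) \<le> \<beta> * (\<gamma> * (norm (x' - x))\<^sup>2)"
      using \<gamma> by (intro mult_right_mono) auto
    thus ?thesis by (simp add: power2_eq_square algebra_simps)
  qed
  ultimately have "F y' - F u \<le> (1 - \<gamma>) * (F y - F u) + \<gamma> * \<eta>
    + \<beta> * \<gamma> / 2 * ((norm (x - u))\<^sup>2 - (norm (x' - u))\<^sup>2)"
    unfolding split by (simp add: algebra_simps)
  thus ?thesis by (simp add: y'_def)
qed

text \<open>After multiplication by k (k + 1) (k + 2) the function gaps telescope, but the squared
  distances carry the growing weight 9 L k / 2. The surplus 9 L d / 2 is bounded through the
  diameter, and the inexactness costs 3 (k + 1) / k \<le> 6 times L D^2; together 6 + 9/2 = 21/2 per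
  step.\<close>

lemma calgd_potential_step:
  fixes k :: real
  assumes k: "k \<ge> 1" and L: "L \<ge> 0"
    and step: "e' \<le> (1 - 3 / (k + 2)) * e + 3 / (k + 2) * (L * D\<^sup>2 / k\<^sup>2)
      + 3 * L / (k + 1) * (3 / (k + 2)) / 2 * (d - d')"
    and prev: "(k - 1) * k * (k + 1) * e + 9 * L / 2 * (k - 1) * d \<le> 21 / 2 * (k - 1) * (L * D\<^sup>2)"
    and d: "d \<le> D\<^sup>2"
  shows "k * (k + 1) * (k + 2) * e' + 9 * L / 2 * k * d' \<le> 21 / 2 * k * (L * D\<^sup>2)"
proof -
  have "k * (k + 1) * (k + 2) * e' \<le> k * (k + 1) * (k + 2) * ((1 - 3 / (k + 2)) * e
      + 3 / (k + 2) * (L * D\<^sup>2 / k\<^sup>2) + 3 * L / (k + 1) * (3 / (k + 2)) / 2 * (d - d'))"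
    using k by (intro mult_left_mono step) auto
  also have "\<dots> = (k - 1) * k * (k + 1) * e + 3 * ((k + 1) / k) * (L * D\<^sup>2) + 9 * L / 2 * k * (d - d')"
  proof -
    have "k * (k + 1) * (k + 2) * (1 - 3 / (k + 2)) = (k - 1) * k * (k + 1)"
      using k by (simp add: field_simps)
    moreover have "k * (k + 1) * (k + 2) * (3 / (k + 2) * (c / k\<^sup>2)) = 3 * ((k + 1) / k) * c" for c
      using k by (simp add: power2_eq_square)
    moreover have "k * (k + 1) * (k + 2) * (3 * L / (k + 1) * (3 / (k + 2)) / 2 * c) = 9 * L / 2 * k * c" for c
      using k by (simp add: divide_simps)
    ultimately show ?thesis
      unfolding distrib_left by (simp only: mult.assoc[symmetric])
  qed
  also have "\<dots> \<le> (k - 1) * k * (k + 1) * e + 3 * 2 * (L * D\<^sup>2) + 9 * L / 2 * k * (d - d')"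
    using k L by (intro add_right_mono add_left_mono mult_right_mono mult_left_mono) (auto simp: field_simps)
  finally have "k * (k + 1) * (k + 2) * e' \<le>
      (k - 1) * k * (k + 1) * e + 6 * (L * D\<^sup>2) + (9 * L / 2 * k * d - 9 * L / 2 * k * d')"
    by (simp add: right_diff_distrib)
  moreover have "9 * L / 2 * (k - 1) * d = 9 * L / 2 * k * d - 9 / 2 * (L * d)"
      "21 / 2 * (k - 1) * (L * D\<^sup>2) = 21 / 2 * k * (L * D\<^sup>2) - 21 / 2 * (L * D\<^sup>2)"
    by (simp_all add: field_simps)
  moreover have "L * d \<le> L * D\<^sup>2"
    using d L by (rule mult_left_mono)
  ultimately show ?thesis
    using prev by linarith
qed

text \<open>M bounds the gradients, so the hypothesis on 2 ^ N keeps each initial gap estimate below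
  2 ^ N times the tolerance. The logarithmic term of the inner loop is then at most N.\<close>

lemma calgd_bound:
  fixes X :: "'a::euclidean_space set" and F :: "real \<Rightarrow> 'a \<Rightarrow> real"
  assumes X: "convex X" "compact X" "x\<^sub>0 \<in> X"
    and D: "D > 0" "\<And>u v. u \<in> X \<Longrightarrow> v \<in> X \<Longrightarrow> norm (u - v) \<le> D"
    and "L > 0" "\<alpha> \<ge> 1"
    and sep: "\<And>j. weak_separation_oracle X (LO j)"
    and G: "\<And>z z'. F \<tau> z + G z \<bullet> (z' - z) \<le> F \<tau> z'"
      "\<And>z z'. F \<tau> z' \<le> F \<tau> z + G z \<bullet> (z' - z) + L / 2 * (norm (z' - z))\<^sup>2"
      "\<And>z. norm (G z) \<le> M"
    and N: "M * D * (real N)\<^sup>2 \<le> 2 ^ N * (L * D\<^sup>2)"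
    and "i \<le> N"
  shows "\<exists>x y j. calgd X LO F \<alpha> (\<lambda>k. 3 * L / (real k + 1)) (\<lambda>k. 3 / (real k + 2))
            (\<lambda>k. L * D\<^sup>2 / (real k)\<^sup>2) (\<lambda>k. \<tau>) x\<^sub>0 i = Some (x, y, 2 * i, j) \<and> x \<in> X \<and> y \<in> X \<and>
    (\<forall>u\<in>X. real i * (real i + 1) * (real i + 2) * (F \<tau> y - F \<tau> u) + 9 * L / 2 * real i * (norm (x - u))\<^sup>2
      \<le> 21 / 2 * real i * (L * D\<^sup>2)) \<and>
    real j \<le> real i * (63 * \<alpha>\<^sup>2 * real N)"
  using \<open>i \<le> N\<close>
proof (induction i)
  case 0
  show ?case using X by auto
next
  case (Suc i)
  define k where "k = real (Suc i)"
  define \<beta> \<gamma> \<eta> where "\<beta> = 3 * L / (k + 1)" and "\<gamma> = 3 / (k + 2)" and "\<eta> = L * D\<^sup>2 / k\<^sup>2"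
  have k: "k \<ge> 1" "k \<le> real N"
    using Suc.prems by (auto simp: k_def)
  obtain x y j where xy: "calgd X LO F \<alpha> (\<lambda>k. 3 * L / (real k + 1)) (\<lambda>k. 3 / (real k + 2))
            (\<lambda>k. L * D\<^sup>2 / (real k)\<^sup>2) (\<lambda>k. \<tau>) x\<^sub>0 i = Some (x, y, 2 * i, j)" "x \<in> X" "y \<in> X"
      "\<And>u. u \<in> X \<Longrightarrow> (k - 1) * k * (k + 1) * (F \<tau> y - F \<tau> u) + 9 * L / 2 * (k - 1) * (norm (x - u))\<^sup>2
        \<le> 21 / 2 * (k - 1) * (L * D\<^sup>2)"
      "real j \<le> real i * (63 * \<alpha>\<^sup>2 * real N)"
    using Suc by (auto simp: k_def add.commute)
  define z where "z = (1 - \<gamma>) *\<^sub>R y + \<gamma> *\<^sub>R x"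
  have "GDERIV (F \<tau>) z :> G z"
  proof (rule gderiv_of_quadratic_bound)
    show "\<bar>F \<tau> y - F \<tau> z - G z \<bullet> (y - z)\<bar> \<le> L / 2 * (norm (y - z))\<^sup>2" for y
      using G(1)[of z y] G(2)[of y z] by linarith
  qed
  hence grad: "grad (F \<tau>) z = G z"
    by (rule grad_eqI)
  have pos: "\<beta> > 0" "\<eta> > 0"
    using k D \<open>L > 0\<close> by (auto simp: \<beta>_def \<eta>_def)
  have \<gamma>: "0 \<le> \<gamma>" "\<gamma> \<le> 1" "L * \<gamma> \<le> \<beta>"
    using k \<open>L > 0\<close> by (auto simp: \<gamma>_def \<beta>_def field_simps)
  have "M \<ge> 0"
    using norm_ge_zero G(3)[of z] by (rule order_trans)
  \<comment> \<open>The tolerance is smallest at k = N, so the hypothesis for N covers all earlier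
    iterations.\<close>
  have "M * D * k\<^sup>2 \<le> M * D * (real N)\<^sup>2"
    using k D \<open>M \<ge> 0\<close> by (intro mult_left_mono power_mono) auto
  hence MD: "M * D \<le> 2 ^ N * \<eta>"
    using N k by (simp add: \<eta>_def field_simps)
  have gap: "G z \<bullet> (x - u) \<le> 2 ^ N * \<eta>" if "u \<in> X" for u
  proof -
    have "G z \<bullet> (x - u) \<le> norm (G z) * norm (x - u)"
      by (rule norm_cauchy_schwarz)
    also have "\<dots> \<le> M * D"
      using G(3)[of z] D(2)[OF \<open>x \<in> X\<close> that] \<open>M \<ge> 0\<close> by (intro mult_mono) auto
    finally show ?thesis using MD by simp
  qed
  have "1 * \<eta> \<le> 2 ^ N * \<eta>"
    using pos by (intro mult_right_mono) auto
  then obtain x' j' where x': "lcg X LO (\<lambda>u. G z \<bullet> u + \<beta> / 2 * (norm (u - x))\<^sup>2) x \<alpha> \<eta> j = Some (x', j')"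
      "x' \<in> X" "\<And>u. u \<in> X \<Longrightarrow> (G z + \<beta> *\<^sub>R (x' - x)) \<bullet> (x' - u) \<le> \<eta>"
      "real j' \<le> real j + (10 * \<alpha> + 5 * \<alpha> * log 2 (2 ^ N * \<eta> / \<eta>) + 16 * \<alpha>\<^sup>2 * (\<beta> * D\<^sup>2) / \<eta>)"
    using lcg_bound[OF X(1,2) \<open>x \<in> X\<close> D pos \<open>\<alpha> \<ge> 1\<close> sep gap] by fastforce
  have "log 2 (2 ^ N * \<eta> / \<eta>) = real N"
    using pos by (simp add: log_nat_power)
  moreover have "\<beta> * D\<^sup>2 / \<eta> \<le> 3 * real N"
  proof -
    have "\<beta> * D\<^sup>2 / \<eta> = 3 * (k * k / (k + 1))"
      using k D \<open>L > 0\<close> by (simp add: \<beta>_def \<eta>_def power2_eq_square)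
    also have "k * k / (k + 1) \<le> k"
      using k by (simp add: field_simps)
    finally show ?thesis using k by simp
  qed
  hence "16 * \<alpha>\<^sup>2 * (\<beta> * D\<^sup>2 / \<eta>) \<le> 16 * \<alpha>\<^sup>2 * (3 * real N)"
    by (intro mult_left_mono) auto
  \<comment> \<open>All three terms become multiples of \<alpha>^2 N, with 10 + 5 + 16 * 3 =
    63.\<close>
  moreover have "\<alpha> * 1 \<le> \<alpha>\<^sup>2 * real N" "\<alpha> * real N \<le> \<alpha>\<^sup>2 * real N"
    using k \<open>\<alpha> \<ge> 1\<close> by (auto simp: power2_eq_square intro!: mult_ge1_I)
  ultimately have calls: "real j' \<le> real j + 63 * \<alpha>\<^sup>2 * real N"
    using x'(4) by simp
  define y' where "y' = (1 - \<gamma>) *\<^sub>R y + \<gamma> *\<^sub>R x'"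
  have "y' \<in> X"
    using convexD_alt[OF X(1) xy(3) x'(2) \<gamma>(1,2)] by (simp add: y'_def)
  moreover have "k * (k + 1) * (k + 2) * (F \<tau> y' - F \<tau> u) + 9 * L / 2 * k * (norm (x' - u))\<^sup>2
      \<le> 21 / 2 * k * (L * D\<^sup>2)" if "u \<in> X" for u
  proof (rule calgd_potential_step[OF k(1) _ _ xy(4)[OF that]])
    show "F \<tau> y' - F \<tau> u \<le> (1 - 3 / (k + 2)) * (F \<tau> y - F \<tau> u) + 3 / (k + 2) * (L * D\<^sup>2 / k\<^sup>2)
      + 3 * L / (k + 1) * (3 / (k + 2)) / 2 * ((norm (x - u))\<^sup>2 - (norm (x' - u))\<^sup>2)"
      using calgd_outer_step[OF G(1,2) \<gamma> z_def x'(3)[OF that]]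
      unfolding y'_def \<beta>_def \<gamma>_def \<eta>_def .
    show "(norm (x - u))\<^sup>2 \<le> D\<^sup>2"
      using D(2)[OF \<open>x \<in> X\<close> that] by (intro power_mono) auto
  qed (use \<open>L > 0\<close> in simp)
  moreover have "calgd X LO F \<alpha> (\<lambda>k. 3 * L / (real k + 1)) (\<lambda>k. 3 / (real k + 2))
            (\<lambda>k. L * D\<^sup>2 / (real k)\<^sup>2) (\<lambda>k. \<tau>) x\<^sub>0 (Suc i) = Some (x', y', 2 * Suc i, j')"
    using x'(1) grad
    by (simp add: xy(1) Let_def y'_def z_def \<beta>_def \<gamma>_def \<eta>_def k_def del: of_nat_Suc)
  moreover have "real j' \<le> real (Suc i) * (63 * \<alpha>\<^sup>2 * real N)"
    using calls xy(5) by (simp add: algebra_simps)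
  ultimately show ?case
    using x'(2) unfolding k_def by blast
qed

section \<open>The smoothed objective: gradient, smoothness and approximation error\<close>

lemma SUP_eq_arg_max:
  fixes f :: "'b \<Rightarrow> real"
  assumes "is_arg_max f (\<lambda>y. y \<in> Y) y"
  shows "(SUP y\<in>Y. f y) = f y"
  using assms by (intro cSup_eq_maximum) (auto simp: is_arg_max_linorder)

text \<open>The gradient inequality is applied at the intermediate point towards both ends. In the
  weighted sum the linear terms cancel and the quadratic weights add up to t (1 - t).\<close>

lemma str_convex_diff_segment:
  assumes sc: "str_convex_diff \<omega> \<omega>' \<sigma> Y" and "convex Y" "x \<in> Y" "y \<in> Y" "0 \<le> t" "t \<le> 1"
  shows "\<omega> ((1 - t) *\<^sub>R x + t *\<^sub>R y) \<le>
    (1 - t) * \<omega> x + t * \<omega> y - \<sigma> / 2 * (t * (1 - t) * (norm (y - x))\<^sup>2)"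
proof -
  define p where "p = (1 - t) *\<^sub>R x + t *\<^sub>R y"
  have "p \<in> Y"
    using convexD_alt[OF assms(2-6)] by (simp add: p_def)
  have x: "x - p = (- t) *\<^sub>R (y - x)" and y: "y - p = (1 - t) *\<^sub>R (y - x)"
    by (simp_all add: p_def algebra_simps)
  have "\<omega> x \<ge> \<omega> p + \<omega>' p \<bullet> (x - p) + \<sigma> / 2 * (norm (x - p))\<^sup>2"
    using sc \<open>p \<in> Y\<close> assms(3) by (simp add: str_convex_diff_def)
  hence "(1 - t) * \<omega> x \<ge>
      (1 - t) * (\<omega> p - t * (\<omega>' p \<bullet> (y - x)) + \<sigma> / 2 * (t\<^sup>2 * (norm (y - x))\<^sup>2))"
    unfolding x using assms by (intro mult_left_mono) (auto simp: power_mult_distrib)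
  moreover have "\<omega> y \<ge> \<omega> p + \<omega>' p \<bullet> (y - p) + \<sigma> / 2 * (norm (y - p))\<^sup>2"
    using sc \<open>p \<in> Y\<close> assms(4) by (simp add: str_convex_diff_def)
  hence "t * \<omega> y \<ge>
      t * (\<omega> p + (1 - t) * (\<omega>' p \<bullet> (y - x)) + \<sigma> / 2 * ((1 - t)\<^sup>2 * (norm (y - x))\<^sup>2))"
    unfolding y using assms by (intro mult_left_mono) (auto simp: power_mult_distrib)
  moreover have "(1 - t) * (\<omega> p - t * (\<omega>' p \<bullet> (y - x)) + \<sigma> / 2 * (t\<^sup>2 * (norm (y - x))\<^sup>2)) +
      t * (\<omega> p + (1 - t) * (\<omega>' p \<bullet> (y - x)) + \<sigma> / 2 * ((1 - t)\<^sup>2 * (norm (y - x))\<^sup>2)) =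
      \<omega> p + \<sigma> / 2 * (t * (1 - t) * (norm (y - x))\<^sup>2)"
    by (simp add: field_simps power2_eq_square)
  ultimately show ?thesis unfolding p_def by linarith
qed

lemma bregman_bounds:
  fixes \<omega> :: "'b::euclidean_space \<Rightarrow> real"
  assumes sc: "str_convex_diff \<omega> \<omega>' \<sigma> Y" and "compact Y" "y \<in> Y"
  shows "0 \<le> bregman \<omega> \<omega>' Y y" "bregman \<omega> \<omega>' Y y \<le> (bregman_diam \<omega> \<omega>' Y)\<^sup>2"
proof -
  have cont: "continuous_on Y \<omega>"
    using sc unfolding str_convex_diff_def
    by (meson continuous_on_eq_continuous_within has_derivative_continuous)
  hence c: "arg_min_on \<omega> Y \<in> Y"
    using arg_min_on_compact(1)[OF \<open>compact Y\<close>] \<open>y \<in> Y\<close> by blast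
  have nonneg: "0 \<le> bregman \<omega> \<omega>' Y z" if "z \<in> Y" for z
  proof -
    have "\<omega> (arg_min_on \<omega> Y) + \<omega>' (arg_min_on \<omega> Y) \<bullet> (z - arg_min_on \<omega> Y)
        + \<sigma> / 2 * (norm (z - arg_min_on \<omega> Y))\<^sup>2 \<le> \<omega> z" "0 < \<sigma>"
      using sc c that by (auto simp: str_convex_diff_def)
    moreover from this have "0 \<le> \<sigma> / 2 * (norm (z - arg_min_on \<omega> Y))\<^sup>2"
      by simp
    ultimately show ?thesis unfolding bregman_def Let_def by linarith
  qed
  thus "0 \<le> bregman \<omega> \<omega>' Y y" using \<open>y \<in> Y\<close> .
  have "continuous_on Y (bregman \<omega> \<omega>' Y)"
    unfolding bregman_def Let_def by (intro continuous_intros cont)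
  \<comment> \<open>Boundedness makes the supremum in \<open>bregman_diam\<close> a genuine one; it
    is nonnegative, so squaring undoes the root.\<close>
  hence "bdd_above (bregman \<omega> \<omega>' Y ` Y)"
    using \<open>compact Y\<close> by (intro bounded_imp_bdd_above compact_imp_bounded compact_continuous_image)
  hence "bregman \<omega> \<omega>' Y y \<le> (SUP z\<in>Y. bregman \<omega> \<omega>' Y z)"
    by (rule cSUP_upper[OF \<open>y \<in> Y\<close>])
  moreover from this have "(bregman_diam \<omega> \<omega>' Y)\<^sup>2 = (SUP z\<in>Y. bregman \<omega> \<omega>' Y z)"
    using nonneg[OF \<open>y \<in> Y\<close>] by (simp add: bregman_diam_def)
  ultimately show "bregman \<omega> \<omega>' Y y \<le> (bregman_diam \<omega> \<omega>' Y)\<^sup>2" by simp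
qed

text \<open>The maximizer is compared with points of the segment towards y. Dividing by t leaves the
  factor 1 - t on the quadratic term, which tends to 1 as t decreases to 0; thus \<open>fhat\<close>
  need only be convex.\<close>

lemma smooth_integrand_growth:
  assumes "convex Y" "convex_on Y fhat" and sc: "str_convex_diff \<omega> \<omega>' \<sigma> Y" and "\<tau> > 0"
    and m: "is_arg_max (smooth_integrand Y A fhat \<omega> \<omega>' \<tau> x) (\<lambda>y. y \<in> Y) m" and "y \<in> Y"
  shows "smooth_integrand Y A fhat \<omega> \<omega>' \<tau> x y + \<tau> * \<sigma> / 2 * (norm (y - m))\<^sup>2
    \<le> smooth_integrand Y A fhat \<omega> \<omega>' \<tau> x m"
proof -
  define q where "q = smooth_integrand Y A fhat \<omega> \<omega>' \<tau> x"
  define r C where "r = \<sigma> / 2 * (norm (y - m))\<^sup>2" and "C = \<tau> * r"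
  have m: "m \<in> Y" "\<And>z. z \<in> Y \<Longrightarrow> q z \<le> q m"
    using m by (auto simp: is_arg_max_linorder q_def)
  have bound: "q y + (1 - t) * C \<le> q m" if t: "0 < t" "t < 1" for t
  proof -
    define p where "p = (1 - t) *\<^sub>R m + t *\<^sub>R y"
    have "p \<in> Y"
      using convexD_alt[OF \<open>convex Y\<close> m(1) \<open>y \<in> Y\<close>] t by (simp add: p_def)
    have "fhat p \<le> (1 - t) * fhat m + t * fhat y"
      using convex_onD[OF \<open>convex_on Y fhat\<close>, of t m y] t m \<open>y \<in> Y\<close> by (simp add: p_def)
    moreover have "\<omega> p \<le> (1 - t) * \<omega> m + t * \<omega> y - t * (1 - t) * r"
      using str_convex_diff_segment[OF sc \<open>convex Y\<close> m(1) \<open>y \<in> Y\<close>, of t] t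
      by (simp add: p_def r_def mult.commute mult.left_commute)
    hence "\<tau> * \<omega> p \<le> \<tau> * ((1 - t) * \<omega> m + t * \<omega> y - t * (1 - t) * r)"
      using \<open>\<tau> > 0\<close> by (intro mult_left_mono) auto
    ultimately have "q p \<ge> (1 - t) * q m + t * q y + t * ((1 - t) * C)"
      unfolding q_def smooth_integrand_def bregman_def Let_def C_def
      by (simp add: p_def inner_diff_right inner_add_right algebra_simps)
    hence "(1 - t) * q m + t * q y + t * ((1 - t) * C) \<le> q m"
      using m(2)[OF \<open>p \<in> Y\<close>] by simp
    hence "t * (q y + (1 - t) * C) \<le> t * q m"
      by (simp add: algebra_simps)
    thus ?thesis using t by simp
  qed
  have "((\<lambda>t. q y + (1 - t) * C) \<longlongrightarrow> q y + (1 - 0) * C) (at_right 0)"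
    by (intro tendsto_intros)
  moreover have "\<forall>\<^sub>F t in at_right 0. q y + (1 - t) * C \<le> q m"
    using bound unfolding eventually_at_right_field by (intro exI[of _ 1]) auto
  ultimately have "q y + (1 - 0) * C \<le> q m"
    by (rule tendsto_upperbound) simp
  thus ?thesis by (simp add: q_def C_def r_def)
qed

text \<open>The lower model holds because the maximizer for z is a competitor for z'. The upper one
  tests the quadratic growth at z with the maximizer for z'. Membership in the image of Y bounds the
  gradients independently of \<tau>.\<close>

lemma smooth_obj_gradient:
  fixes A :: "'a::euclidean_space \<Rightarrow> 'b::euclidean_space"
  assumes "convex Y" "linear A" "convex_on Y fhat" and sc: "str_convex_diff \<omega> \<omega>' \<sigma> Y" and "\<tau> > 0"
    and solvable: "\<And>x. \<exists>y. is_arg_max (smooth_integrand Y A fhat \<omega> \<omega>' \<tau> x) (\<lambda>y. y \<in> Y) y"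
  defines "F \<equiv> smooth_obj Y A fhat \<omega> \<omega>' \<tau>"
  obtains G where "\<And>z z'. F z + G z \<bullet> (z' - z) \<le> F z'"
    "\<And>z z'. F z' \<le> F z + G z \<bullet> (z' - z) + (onorm A)\<^sup>2 / (\<tau> * \<sigma>) / 2 * (norm (z' - z))\<^sup>2"
    "\<And>z. G z \<in> adjoint A ` Y"
proof -
  define q where "q = smooth_integrand Y A fhat \<omega> \<omega>' \<tau>"
  obtain m where argmax: "\<And>x. is_arg_max (q x) (\<lambda>y. y \<in> Y) (m x)"
    using solvable unfolding q_def by metis
  have m: "m x \<in> Y" "y \<in> Y \<Longrightarrow> q x y \<le> q x (m x)" for x y
    using argmax[of x] by (auto simp: is_arg_max_linorder)
  have F: "F x = q x (m x)" for x
    using SUP_eq_arg_max[OF argmax[of x]] by (simp add: F_def smooth_obj_def q_def)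
  have shift: "q x' y = q x y + A (x' - x) \<bullet> y" for x x' y
    by (simp add: q_def smooth_integrand_def linear_diff[OF \<open>linear A\<close>] inner_diff_left)
  have adj: "adjoint A y \<bullet> h = A h \<bullet> y" for y h
    using adjoint_clauses(2)[OF \<open>linear A\<close>] by (simp add: inner_commute)
  show ?thesis
  proof (rule that[of "\<lambda>x. adjoint A (m x)"])
    show "F z + adjoint A (m z) \<bullet> (z' - z) \<le> F z'" for z z'
      using m(2)[OF m(1), of z' z] by (simp add: F shift[of z' _ z] adj)
    show "F z' \<le> F z + adjoint A (m z) \<bullet> (z' - z) + (onorm A)\<^sup>2 / (\<tau> * \<sigma>) / 2 * (norm (z' - z))\<^sup>2" for z z'
    proof -
      define h e where "h = z' - z" and "e = m z' - m z"
      define c where "c = \<tau> * \<sigma>"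
      have "c > 0" using sc \<open>\<tau> > 0\<close> by (simp add: c_def str_convex_diff_def)
      have "A h \<bullet> e \<le> norm (A h) * norm e"
        by (rule norm_cauchy_schwarz)
      also have "\<dots> \<le> (onorm A * norm h) * norm e"
        using \<open>linear A\<close> by (intro mult_right_mono onorm) (auto simp: linear_conv_bounded_linear)
      \<comment> \<open>Young's inequality, weighted so that the term in e is exactly what the
        growth estimate supplies.\<close>
      also have "\<dots> \<le> c / 2 * (norm e)\<^sup>2 + (onorm A * norm h)\<^sup>2 / (2 * c)"
      proof -
        have "0 \<le> (c * norm e - onorm A * norm h)\<^sup>2 / (2 * c)"
          using \<open>c > 0\<close> by simp
        also have "\<dots> = c / 2 * (norm e)\<^sup>2 + (onorm A * norm h)\<^sup>2 / (2 * c) - (onorm A * norm h) * norm e"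
          using \<open>c > 0\<close> by (simp add: power2_diff field_simps power2_eq_square)
        finally show ?thesis by simp
      qed
      finally have "A h \<bullet> e \<le> c / 2 * (norm e)\<^sup>2 + (onorm A)\<^sup>2 / c / 2 * (norm h)\<^sup>2"
        by (simp add: power_mult_distrib field_simps)
      moreover have "q z (m z') + c / 2 * (norm e)\<^sup>2 \<le> q z (m z)"
        using smooth_integrand_growth[OF \<open>convex Y\<close> \<open>convex_on Y fhat\<close> sc \<open>\<tau> > 0\<close> argmax[unfolded q_def] m(1)]
        by (simp add: q_def c_def e_def)
      moreover have "F z' = q z (m z') + A h \<bullet> m z + A h \<bullet> e"
        by (simp add: F shift[of z' _ z] h_def e_def inner_diff_right)
      ultimately show ?thesis
        by (simp add: F adj h_def c_def)
    qed
    show "adjoint A (m z) \<in> adjoint A ` Y" for z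
      using m(1) by simp
  qed
qed

text \<open>The added term - \<tau> (W - \<D>^2) lies between 0 and \<tau> \<D>^2 on Y.\<close>

lemma smooth_obj_approx:
  fixes A :: "'a::real_inner \<Rightarrow> 'b::euclidean_space"
  assumes "compact Y" "str_convex_diff \<omega> \<omega>' \<sigma> Y" "\<tau> > 0"
    and m: "is_arg_max (smooth_integrand Y A fhat \<omega> \<omega>' \<tau> x) (\<lambda>y. y \<in> Y) m"
  shows "saddle_obj Y A fhat x \<le> smooth_obj Y A fhat \<omega> \<omega>' \<tau> x"
    "smooth_obj Y A fhat \<omega> \<omega>' \<tau> x \<le> saddle_obj Y A fhat x + \<tau> * (bregman_diam \<omega> \<omega>' Y)\<^sup>2"
proof -
  define q where "q = smooth_integrand Y A fhat \<omega> \<omega>' \<tau> x"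
  have m': "m \<in> Y" "\<And>z. z \<in> Y \<Longrightarrow> q z \<le> q m"
    using m by (auto simp: is_arg_max_linorder q_def)
  have F: "smooth_obj Y A fhat \<omega> \<omega>' \<tau> x = q m"
    using SUP_eq_arg_max[OF m] by (simp add: smooth_obj_def q_def)
  have le: "A x \<bullet> y - fhat y \<le> q m" if "y \<in> Y" for y
  proof -
    have "\<tau> * (bregman \<omega> \<omega>' Y y - (bregman_diam \<omega> \<omega>' Y)\<^sup>2) \<le> 0"
      using bregman_bounds(2)[OF assms(2,1) that] \<open>\<tau> > 0\<close> by (simp add: mult_nonneg_nonpos)
    thus ?thesis using m'(2)[OF that] by (simp add: q_def smooth_integrand_def)
  qed
  thus "saddle_obj Y A fhat x \<le> smooth_obj Y A fhat \<omega> \<omega>' \<tau> x"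
    unfolding F saddle_obj_def using m'(1) by (intro cSUP_least) auto
  have "bdd_above ((\<lambda>y. A x \<bullet> y - fhat y) ` Y)"
    using le by (auto simp: bdd_above_def)
  hence "A x \<bullet> m - fhat m \<le> saddle_obj Y A fhat x"
    unfolding saddle_obj_def using m'(1) by (rule cSUP_upper[rotated])
  moreover have "0 \<le> \<tau> * bregman \<omega> \<omega>' Y m"
    using bregman_bounds(1)[OF assms(2,1) m'(1)] \<open>\<tau> > 0\<close> by simp
  ultimately show "smooth_obj Y A fhat \<omega> \<omega>' \<tau> x \<le> saddle_obj Y A fhat x + \<tau> * (bregman_diam \<omega> \<omega>' Y)\<^sup>2"
    unfolding F by (simp add: q_def smooth_integrand_def algebra_simps)
qed

section \<open>Choice of N and the complexity bounds\<close>

lemma eps_solutionI: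
  assumes "y \<in> X" "\<And>u. u \<in> X \<Longrightarrow> f y - f u \<le> \<epsilon>"
  shows "eps_solution X f \<epsilon> y"
proof -
  have "f y - \<epsilon> \<le> (INF u\<in>X. f u)"
    using assms by (intro cINF_greatest) (auto simp: algebra_simps)
  thus ?thesis using assms by (simp add: eps_solution_def)
qed

theorem corollary12:
  fixes X :: "(real ^ 'n) set" and Y :: "(real ^ 'm) set"
    and A :: "real ^ 'n \<Rightarrow> real ^ 'm"
    and fhat \<omega> :: "real ^ 'm \<Rightarrow> real" and \<omega>' :: "real ^ 'm \<Rightarrow> real ^ 'm"
    and \<sigma> \<alpha> :: real and x\<^sub>0 :: "real ^ 'n"
  assumes "convex X" "compact X" "x\<^sub>0 \<in> X"
    and "convex Y" "compact Y" "Y \<noteq> {}"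
    and "linear A"
    and "convex_on Y fhat"
    and "str_convex_diff \<omega> \<omega>' \<sigma> Y"
    and solvable: "\<And>\<tau> x. \<tau> > 0 \<Longrightarrow>
          \<exists>y. is_arg_max (smooth_integrand Y A fhat \<omega> \<omega>' \<tau> x) (\<lambda>y. y \<in> Y) y"
    and nondegenerate: "onorm A > 0" "diameter X > 0" "bregman_diam \<omega> \<omega>' Y > 0"
    and "\<alpha> \<ge> 1"
  shows "\<exists>\<epsilon>\<^sub>0>0. \<forall>\<epsilon>. 0 < \<epsilon> \<and> \<epsilon> < \<epsilon>\<^sub>0 \<longrightarrow> (\<exists>N::nat. N \<ge> 1 \<and>
    (let D = bregman_diam \<omega> \<omega>' Y;
         \<tau> = 2 * onorm A * diameter X / (D * sqrt \<sigma> * real N);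
         L = (onorm A)\<^sup>2 / (\<tau> * \<sigma>)
     in \<forall>LO. (\<forall>j. weak_separation_oracle X (LO j)) \<longrightarrow>
       (\<exists>x y ops calls.
          calgd X LO (smooth_obj Y A fhat \<omega> \<omega>') \<alpha>
            (\<lambda>k. 3 * L / (real k + 1)) (\<lambda>k. 3 / (real k + 2))
            (\<lambda>k. L * (diameter X)\<^sup>2 / (real k)\<^sup>2) (\<lambda>k. \<tau>) x\<^sub>0 N
          = Some (x, y, ops, calls) \<and>
          eps_solution X (saddle_obj Y A fhat) \<epsilon> y \<and>
          real ops \<le> calgd_const \<alpha> * (onorm A * diameter X * D / (sqrt \<sigma> * \<epsilon>)) \<and>
          real calls \<le> calgd_const \<alpha> *
            ((onorm A)\<^sup>2 * (diameter X)\<^sup>2 * D\<^sup>2 / (\<sigma> * \<epsilon>\<^sup>2)))))"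
proof -
  define a d D where "a = onorm A" and "d = diameter X" and "D = bregman_diam \<omega> \<omega>' Y"
  have "\<sigma> > 0"
    using assms(9) by (simp add: str_convex_diff_def)
  define s where "s = sqrt \<sigma>"
  have s: "s > 0" "\<sigma> = s\<^sup>2"
    using \<open>\<sigma> > 0\<close> by (simp_all add: s_def)
  have pos: "a > 0" "d > 0" "D > 0"
    using nondegenerate by (simp_all add: a_def d_def D_def)
  define Q where "Q = a * d * D / s"
  have "Q > 0" using pos s by (simp add: Q_def)
  \<comment> \<open>M serves all \<tau> at once, so \<open>N\<^sub>0\<close> can be fixed before
    \<epsilon>, N and \<tau>.\<close>
  have "bounded (adjoint A ` Y)"
    using adjoint_linear[OF \<open>linear A\<close>] \<open>compact Y\<close>
    by (intro bounded_linear_image compact_imp_bounded) (auto simp: linear_conv_bounded_linear)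
  then obtain M where M: "M > 0" "\<And>v. v \<in> adjoint A ` Y \<Longrightarrow> norm v \<le> M"
    unfolding bounded_pos by blast
  \<comment> \<open>As L d^2 will equal Q N / 2, the hypothesis of \<open>calgd_bound\<close>
    amounts to N / 2 ^ N \<le> Q / (2 M d).\<close>
  have "(\<lambda>n. real n / 2 ^ n) \<longlonglongrightarrow> 0"
    using lim_n_over_pown[of "2::real"] by simp
  hence "\<forall>\<^sub>F n in sequentially. real n / 2 ^ n < Q / (2 * M * d)"
    using \<open>Q > 0\<close> M pos by (intro order_tendstoD(2)) auto
  then obtain N\<^sub>0 where N\<^sub>0: "\<And>n. n \<ge> N\<^sub>0 \<Longrightarrow> real n / 2 ^ n < Q / (2 * M * d)"
    unfolding eventually_sequentially by blast
  show ?thesis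
  \<comment> \<open>The bound by Q makes rounding N up cost at most Q / \<epsilon>; the other one
    forces N \<ge> \<open>N\<^sub>0\<close>.\<close>
  proof (intro exI[of _ "min Q (8 * Q / (real N\<^sub>0 + 1))"] conjI allI impI)
    show "min Q (8 * Q / (real N\<^sub>0 + 1)) > 0" using \<open>Q > 0\<close> by simp
    fix \<epsilon> assume "0 < \<epsilon> \<and> \<epsilon> < min Q (8 * Q / (real N\<^sub>0 + 1))"
    hence \<epsilon>: "0 < \<epsilon>" "\<epsilon> < Q" "\<epsilon> < 8 * Q / (real N\<^sub>0 + 1)" by auto
    \<comment> \<open>The factor 8 covers the optimization error 6 Q / N and the smoothing error 2 Q
      / N.\<close>
    define N where "N = nat \<lceil>8 * Q / \<epsilon>\<rceil>"
    have "8 * Q / \<epsilon> > 0" using \<epsilon> \<open>Q > 0\<close> by simp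
    hence N: "8 * Q / \<epsilon> \<le> real N" "real N \<le> 8 * Q / \<epsilon> + 1"
      unfolding N_def by linarith+
    have "1 < Q / \<epsilon>" using \<epsilon> by simp
    hence N9: "real N \<le> 9 * Q / \<epsilon>" and "N \<ge> 1"
      using N by auto
    have "real N\<^sub>0 + 1 < 8 * Q / \<epsilon>"
      using \<epsilon> by (simp add: field_simps)
    hence "N \<ge> N\<^sub>0" using N by simp
    define \<tau> where "\<tau> = 2 * a * d / (D * s * real N)"
    have "\<tau> > 0" using pos s \<open>N \<ge> 1\<close> by (simp add: \<tau>_def)
    define L where "L = a\<^sup>2 / (\<tau> * \<sigma>)"
    have "L > 0" using pos \<open>\<tau> > 0\<close> \<open>\<sigma> > 0\<close> by (simp add: L_def)
    have Ld: "L * d\<^sup>2 = Q * real N / 2"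
      using pos s(1) \<open>N \<ge> 1\<close> unfolding L_def \<tau>_def Q_def s(2)
      by (simp add: field_simps power2_eq_square)
    have \<tau>D: "\<tau> * D\<^sup>2 = 2 * Q / real N"
      using pos s(1) \<open>N \<ge> 1\<close> unfolding \<tau>_def Q_def
      by (simp add: field_simps power2_eq_square)
    define F where "F = smooth_obj Y A fhat \<omega> \<omega>'"
    obtain G where G: "\<And>z z'. F \<tau> z + G z \<bullet> (z' - z) \<le> F \<tau> z'"
      "\<And>z z'. F \<tau> z' \<le> F \<tau> z + G z \<bullet> (z' - z) + L / 2 * (norm (z' - z))\<^sup>2"
      "\<And>z. G z \<in> adjoint A ` Y"
      using smooth_obj_gradient[OF assms(4,7,8,9) \<open>\<tau> > 0\<close> solvable[OF \<open>\<tau> > 0\<close>]]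
      unfolding F_def L_def a_def by metis
    have scale: "M * d * (real N)\<^sup>2 \<le> 2 ^ N * (L * d\<^sup>2)"
    proof -
      have "real N * (2 * M * d) \<le> Q * 2 ^ N"
        using N\<^sub>0[OF \<open>N \<ge> N\<^sub>0\<close>] M pos by (simp add: field_simps)
      hence "real N * (2 * M * d) * (real N / 2) \<le> Q * 2 ^ N * (real N / 2)"
        by (rule mult_right_mono) simp
      thus ?thesis unfolding Ld by (simp add: power2_eq_square algebra_simps)
    qed
    have diam: "norm (u - v) \<le> d" if "u \<in> X" "v \<in> X" for u v
      using diameter_bounded_bound[OF compact_imp_bounded[OF \<open>compact X\<close>] that]
      by (simp add: d_def dist_norm)
    have result: "\<exists>x y ops calls. calgd X LO F \<alpha> (\<lambda>k. 3 * L / (real k + 1)) (\<lambda>k. 3 / (real k + 2))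
            (\<lambda>k. L * d\<^sup>2 / (real k)\<^sup>2) (\<lambda>k. \<tau>) x\<^sub>0 N = Some (x, y, ops, calls) \<and>
          eps_solution X (saddle_obj Y A fhat) \<epsilon> y \<and>
          real ops \<le> calgd_const \<alpha> * (a * d * D / (s * \<epsilon>)) \<and>
          real calls \<le> calgd_const \<alpha> * (a\<^sup>2 * d\<^sup>2 * D\<^sup>2 / (\<sigma> * \<epsilon>\<^sup>2))"
      if sep: "\<forall>j. weak_separation_oracle X (LO j)" for LO
    proof -
      obtain x y j where run: "calgd X LO F \<alpha> (\<lambda>k. 3 * L / (real k + 1)) (\<lambda>k. 3 / (real k + 2))
            (\<lambda>k. L * d\<^sup>2 / (real k)\<^sup>2) (\<lambda>k. \<tau>) x\<^sub>0 N = Some (x, y, 2 * N, j)"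
        "x \<in> X" "y \<in> X"
        "\<And>u. u \<in> X \<Longrightarrow> real N * (real N + 1) * (real N + 2) * (F \<tau> y - F \<tau> u)
            + 9 * L / 2 * real N * (norm (x - u))\<^sup>2 \<le> 21 / 2 * real N * (L * d\<^sup>2)"
        "real j \<le> real N * (63 * \<alpha>\<^sup>2 * real N)"
        using calgd_bound[where LO = LO and F = F, OF assms(1-3) pos(2) diam \<open>L > 0\<close> \<open>\<alpha> \<ge> 1\<close>
            sep[rule_format] G(1,2) M(2)[OF G(3)] scale order_refl]
        by blast
      have "saddle_obj Y A fhat y - saddle_obj Y A fhat u \<le> \<epsilon>" if "u \<in> X" for u
      proof -
        have "0 \<le> 9 * L / 2 * real N * (norm (x - u))\<^sup>2"
          using \<open>L > 0\<close> by simp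
        moreover have Ld_N: "21 / 2 * real N * (L * d\<^sup>2) = 21 / 4 * Q * (real N)\<^sup>2"
          unfolding Ld by (simp add: power2_eq_square)
        ultimately have e: "real N * (real N + 1) * (real N + 2) * (F \<tau> y - F \<tau> u) \<le> 21 / 4 * Q * (real N)\<^sup>2"
          using run(4)[OF that] Ld_N by linarith
        have "F \<tau> y - F \<tau> u \<le> 6 * Q / real N"
        proof (rule ccontr)
          assume "\<not> ?thesis"
          hence "real N * (real N + 1) * (real N + 2) * (F \<tau> y - F \<tau> u) >
              real N * (real N + 1) * (real N + 2) * (6 * Q / real N)"
            using \<open>N \<ge> 1\<close> by (intro mult_strict_left_mono) auto
          also have "real N * (real N + 1) * (real N + 2) * (6 * Q / real N) =
              6 * Q * ((real N)\<^sup>2 + 3 * real N + 2)"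
            using \<open>N \<ge> 1\<close> by (simp add: field_simps power2_eq_square)
          finally have "6 * Q * ((real N)\<^sup>2 + 3 * real N + 2) < 21 / 4 * Q * (real N)\<^sup>2"
            using e by linarith
          \<comment> \<open>The constant 21/4 is half of 21/2, from L d^2 = Q N / 2; rounding it up
            to 6 gives the contradiction.\<close>
          moreover have "21 / 4 * Q * (real N)\<^sup>2 \<le> 6 * Q * ((real N)\<^sup>2 + 3 * real N + 2)"
            using \<open>Q > 0\<close> by (intro mult_mono) auto
          ultimately show False by linarith
        qed
        moreover have "saddle_obj Y A fhat y \<le> F \<tau> y" "F \<tau> u \<le> saddle_obj Y A fhat u + \<tau> * D\<^sup>2"
          using smooth_obj_approx[OF assms(5,9) \<open>\<tau> > 0\<close>] solvable[OF \<open>\<tau> > 0\<close>]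
          unfolding F_def D_def by blast+
        moreover have "6 * Q / real N + 2 * Q / real N \<le> \<epsilon>"
          using N \<epsilon> \<open>N \<ge> 1\<close> by (simp add: field_simps)
        ultimately show ?thesis unfolding \<tau>D by linarith
      qed
      hence "eps_solution X (saddle_obj Y A fhat) \<epsilon> y"
        using run(3) by (intro eps_solutionI)
      moreover have "real (2 * N) \<le> calgd_const \<alpha> * (a * d * D / (s * \<epsilon>))"
      proof -
        have "real (2 * N) \<le> 18 * (Q / \<epsilon>)"
          using N9 by simp
        also have "\<dots> \<le> calgd_const \<alpha> * (Q / \<epsilon>)"
          using one_le_power[OF \<open>\<alpha> \<ge> 1\<close>, of 2] \<open>Q > 0\<close> \<epsilon>
          by (intro mult_right_mono) (auto simp: calgd_const_def)
        finally show ?thesis by (simp add: Q_def)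
      qed
      moreover have "real j \<le> calgd_const \<alpha> * (a\<^sup>2 * d\<^sup>2 * D\<^sup>2 / (\<sigma> * \<epsilon>\<^sup>2))"
      proof -
        \<comment> \<open>The square of N \<le> 9 Q / \<epsilon> yields 63 * 81 = 5103, below the
          constant in \<open>calgd_const\<close>.\<close>
        have "real j \<le> 63 * \<alpha>\<^sup>2 * (real N)\<^sup>2"
          using run(5) by (simp add: power2_eq_square mult_ac)
        also have "\<dots> \<le> 63 * \<alpha>\<^sup>2 * (9 * Q / \<epsilon>)\<^sup>2"
          using N9 by (intro mult_left_mono power_mono) auto
        also have "\<dots> = 5103 * \<alpha>\<^sup>2 * (Q / \<epsilon>)\<^sup>2"
          by (simp add: power_divide power_mult_distrib)
        also have "\<dots> \<le> calgd_const \<alpha> * (Q / \<epsilon>)\<^sup>2"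
          by (intro mult_right_mono) (auto simp: calgd_const_def)
        also have "(Q / \<epsilon>)\<^sup>2 = a\<^sup>2 * d\<^sup>2 * D\<^sup>2 / (\<sigma> * \<epsilon>\<^sup>2)"
          by (simp add: Q_def s(2) power_divide power_mult_distrib)
        finally show ?thesis .
      qed
      ultimately show ?thesis using run(1) by blast
    qed
    show "\<exists>N\<ge>1. (let D = bregman_diam \<omega> \<omega>' Y;
         \<tau> = 2 * onorm A * diameter X / (D * sqrt \<sigma> * real N);
         L = (onorm A)\<^sup>2 / (\<tau> * \<sigma>)
     in \<forall>LO. (\<forall>j. weak_separation_oracle X (LO j)) \<longrightarrow>
       (\<exists>x y ops calls.
          calgd X LO (smooth_obj Y A fhat \<omega> \<omega>') \<alpha>
            (\<lambda>k. 3 * L / (real k + 1)) (\<lambda>k. 3 / (real k + 2))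
            (\<lambda>k. L * (diameter X)\<^sup>2 / (real k)\<^sup>2) (\<lambda>k. \<tau>) x\<^sub>0 N
          = Some (x, y, ops, calls) \<and>
          eps_solution X (saddle_obj Y A fhat) \<epsilon> y \<and>
          real ops \<le> calgd_const \<alpha> * (onorm A * diameter X * D / (sqrt \<sigma> * \<epsilon>)) \<and>
          real calls \<le> calgd_const \<alpha> *
            ((onorm A)\<^sup>2 * (diameter X)\<^sup>2 * D\<^sup>2 / (\<sigma> * \<epsilon>\<^sup>2))))"
      using result unfolding F_def L_def \<tau>_def a_def d_def D_def s_def Let_def
      by (intro exI[of _ N] conjI \<open>N \<ge> 1\<close> allI impI) blast
  qed
qed

end
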